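(* Let $T$ be a tree with $n\ge 3$ vertices. Then $\mathrm{sd}(T)=\mathrm{msd}(T)$.
   Context: $\gamma(G)$ is the domination number of $G$ (minimum size of a set $D\subseteq V(G)$ such that every vertex outside $D$ has a neighbour in $D$). $\mathrm{sd}(G)$ (domination subdivision number, for connected graphs of order at least 3) is the minimum number of edges that must be subdivided, each edge at most once (replacing edge $uv$ by a path $(u,x,v)$ with a new vertex $x$), in order to increase $\gamma$. For an edge $e=uv$ and $t\ge1$, $G_{e,t}$ is the graph obtained by replacing $e$ by a path $(u,x_1,\ldots,x_t,v)$ with $t$ new vertices; $\mathrm{msd}(uv)$ is the minimum positive integer $t$ with $\gamma(G_{uv,t})>\gamma(G)$, and $\mathrm{msd}(G)=\min_{uv\in E(G)}\mathrm{msd}(uv)$. *)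

theory Defs
  imports "Graph_Theory.Graph_Theory"
begin

text \<open>
  A finite simple graph is a \<^locale>\<open>pair_graph\<close>: an undirected edge \<open>uv\<close> is the pair of
  opposite arcs \<open>(u, v)\<close> and \<open>(v, u)\<close>.  Because of these pairs, \<open>u v u\<close> is a
  \<^const>\<open>pre_digraph.cycle\<close> for every edge \<open>uv\<close>, so that \<^const>\<open>forest\<close> and \<^const>\<open>tree\<close>
  fail for every graph with an edge.  The cycles of the undirected graph are the directed
  cycles of length at least 3.
\<close>

definition undirected_tree :: "'a pair_pre_digraph \<Rightarrow> bool" where
  "undirected_tree G \<longleftrightarrow> pair_graph G \<and> connected (with_proj G) \<and>
    \<not> (\<exists>p. pre_digraph.cycle (with_proj G) p \<and> length p \<ge> 3)"

definition edges :: "'a pair_pre_digraph \<Rightarrow> 'a set set" where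
  "edges G = {{u, v} | u v. (u, v) \<in> parcs G}"

definition dominating_set :: "'a pair_pre_digraph \<Rightarrow> 'a set \<Rightarrow> bool" where
  "dominating_set G D \<longleftrightarrow> D \<subseteq> pverts G \<and> (\<forall>v \<in> pverts G - D. \<exists>u \<in> D. (v, u) \<in> parcs G)"

definition domination_number :: "'a pair_pre_digraph \<Rightarrow> nat" where
  "domination_number G = (LEAST k. \<exists>D. dominating_set G D \<and> card D = k)"

text \<open>
  Every edge \<open>e\<close> in \<open>F\<close> is subdivided once; \<open>Inr e\<close> is its new vertex.
\<close>

definition subdivide_edges :: "'a pair_pre_digraph \<Rightarrow> 'a set set \<Rightarrow> ('a + 'a set) pair_pre_digraph" where
  "subdivide_edges G F =
    \<lparr> pverts = Inl ` pverts G \<union> Inr ` F,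
      parcs = {(Inl u, Inl v) | u v. (u, v) \<in> parcs G \<and> {u, v} \<notin> F}
        \<union> {(Inl u, Inr e) | u e. e \<in> F \<and> u \<in> e}
        \<union> {(Inr e, Inl u) | u e. e \<in> F \<and> u \<in> e} \<rparr>"

text \<open>
  The minimum exists for connected graphs with at least three vertices; otherwise the value
  may be unspecified.
\<close>

definition sd :: "'a pair_pre_digraph \<Rightarrow> nat" where
  "sd G = (LEAST k. \<exists>F \<subseteq> edges G. card F = k \<and>
    domination_number (subdivide_edges G F) > domination_number G)"

text \<open>
  The edge \<open>uv\<close> is replaced by the path \<open>u, x\<^sub>1, \<dots>, x\<^sub>t, v\<close>, where \<open>x\<^sub>i\<close> is \<open>Inr i\<close>.  This is
  meant for \<open>t \<ge> 1\<close> only.  Exchanging \<open>u\<close> and \<open>v\<close> gives an isomorphic graph.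
\<close>

definition subdivide_path :: "'a pair_pre_digraph \<Rightarrow> 'a \<Rightarrow> 'a \<Rightarrow> nat \<Rightarrow> ('a + nat) pair_pre_digraph" where
  "subdivide_path G u v t =
    (let P = {(Inl u, Inr 1), (Inr t, Inl v)} \<union> {(Inr i, Inr (i + 1)) | i. 1 \<le> i \<and> i < t}
     in \<lparr> pverts = Inl ` pverts G \<union> Inr ` {1..t},
          parcs = {(Inl a, Inl b) | a b. (a, b) \<in> parcs G \<and> {a, b} \<noteq> {u, v}} \<union> P \<union> P\<inverse> \<rparr>)"

definition msd_edge :: "'a pair_pre_digraph \<Rightarrow> 'a \<Rightarrow> 'a \<Rightarrow> nat" where
  "msd_edge G u v = (LEAST t. t \<ge> 1 \<and>
    domination_number (subdivide_path G u v t) > domination_number G)"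

definition msd :: "'a pair_pre_digraph \<Rightarrow> nat" where
  "msd G = (MIN (u, v) \<in> parcs G. msd_edge G u v)"

lemma pair_graph_subdivide_edges:
  assumes "pair_graph G" "F \<subseteq> edges G"
  shows "pair_graph (subdivide_edges G F)"
proof -
  interpret G: pair_graph G by fact
  have sub: "u \<in> pverts G" if "e \<in> F" "u \<in> e" for e u
    using that assms(2) G.wellformed' by (fastforce simp: edges_def)
  have "edges G \<subseteq> Pow (pverts G)"
    using G.wellformed' by (fastforce simp: edges_def)
  then have finF: "finite F"
    using assms(2) G.pair_finite_verts by (meson finite_Pow_iff finite_subset)
  have wf: "parcs (subdivide_edges G F)
      \<subseteq> pverts (subdivide_edges G F) \<times> pverts (subdivide_edges G F)"
    using sub G.wellformed' by (auto simp: subdivide_edges_def)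
  have finV: "finite (pverts (subdivide_edges G F))"
    using finF G.pair_finite_verts by (simp add: subdivide_edges_def)
  have "sym (parcs G)"
    using G.pair_sym_arcs by (simp add: symmetric_def)
  then have "sym (parcs (subdivide_edges G F))"
    by (auto simp: subdivide_edges_def sym_def insert_commute)
  then show ?thesis
    using wf finV finite_subset[OF wf] G.pair_no_loops
    by unfold_locales (auto simp: symmetric_def, auto simp: subdivide_edges_def)
qed

lemma pair_graph_subdivide_path:
  assumes "pair_graph G" "(u, v) \<in> parcs G" "t \<ge> 1"
  shows "pair_graph (subdivide_path G u v t)"
proof -
  interpret G: pair_graph G by fact
  have wf: "parcs (subdivide_path G u v t)
      \<subseteq> pverts (subdivide_path G u v t) \<times> pverts (subdivide_path G u v t)"
    using assms G.wellformed' by (auto simp: subdivide_path_def Let_def)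
  have finV: "finite (pverts (subdivide_path G u v t))"
    using G.pair_finite_verts by (simp add: subdivide_path_def Let_def)
  have "sym (parcs G)"
    using G.pair_sym_arcs by (simp add: symmetric_def)
  then have "sym (parcs (subdivide_path G u v t))"
    by (auto simp: subdivide_path_def Let_def sym_def doubleton_eq_iff)
  then show ?thesis
    using wf finV finite_subset[OF wf] G.pair_no_loops
    by unfold_locales (auto simp: symmetric_def, auto simp: subdivide_path_def Let_def)
qed

end

theory Submission
  imports Defs
begin

text \<open>
  Let \<open>A\<close> be the set of critical vertices, those \<open>a\<close> for which fewer than \<open>\<gamma>\<close> vertices dominate
  everything except \<open>a\<close>.  Exchanging two such sets across an edge of the tree shows that closed
  neighbourhoods of distinct critical vertices are disjoint.

  Subdividing \<open>uv\<close> twice keeps \<open>\<gamma>\<close> only if \<open>u\<close> or \<open>v\<close> is critical or some minimum dominating set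
  contains both; if this holds for every edge, then \<open>A\<close> dominates the tree, because otherwise the
  minimum dominating sets for the edges at an undominated vertex could be merged, branch by
  branch, into a smaller one.  For an edge that violates the condition, comparing the costs of dominating its
  two sides yields at most two edges incident to a common vertex whose subdivision raises \<open>\<gamma>\<close>.
  So if \<open>A\<close> does not dominate the tree, both parameters are at most 2.

  If \<open>A\<close> is dominating, it is a perfect code.  Each of its two halves at an edge \<open>e\<close> can be
  rearranged, at no cost and without touching the other half, so as to dominate the new vertex on
  \<open>e\<close>.  For two edges one rearranges two disjoint sides, so two subdivisions do not raise \<open>\<gamma>\<close>; the
  same works for two new vertices on one edge.  Subdividing the three edges of a path
  \<open>a, b, c, d\<close> with \<open>a, d \<in> A\<close> does raise \<open>\<gamma>\<close>, since \<open>A\<close> and the new vertex on \<open>bc\<close> form a packing.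
  Three new vertices on one edge always raise \<open>\<gamma>\<close>, so both parameters are 3.  They trivially agree
  when a single subdivision suffices.
\<close>

section \<open>Dominating sets of subdivided graphs\<close>

text \<open>The whole vertex set dominates, so the \<open>LEAST\<close> in the definition is
  attained. Later upper and lower bounds are read off from this equivalence.\<close>

lemma domination_number_le_iff:
  "domination_number G \<le> k \<longleftrightarrow> (\<exists>D. dominating_set G D \<and> card D \<le> k)"
proof
  let ?P = "\<lambda>k. \<exists>D. dominating_set G D \<and> card D = k"
  have "dominating_set G (pverts G)"
    by (simp add: dominating_set_def)
  then have "?P (card (pverts G))"
    by blast
  then have "?P (domination_number G)"
    unfolding domination_number_def by (rule LeastI[of ?P])
  then show "\<exists>D. dominating_set G D \<and> card D \<le> k" if "domination_number G \<le> k"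
    using that by auto
  have "domination_number G \<le> card D" if "dominating_set G D" for D
    using that unfolding domination_number_def by (intro Least_le) blast
  then show "domination_number G \<le> k" if "\<exists>D. dominating_set G D \<and> card D \<le> k"
    using that order_trans by blast
qed

text \<open>Choosing a witness for each element of \<open>P\<close> gives an injection into
  \<open>D\<close>. Both packing bounds below rest on this count.\<close>

lemma card_le_if_common_witness_unique:
  assumes "finite D" "\<And>p. p \<in> P \<Longrightarrow> \<exists>d\<in>D. R p d"
    and "\<And>p q d. p \<in> P \<Longrightarrow> q \<in> P \<Longrightarrow> R p d \<Longrightarrow> R q d \<Longrightarrow> p = q"
  shows "card P \<le> card D"
proof -
  obtain f where f: "\<And>p. p \<in> P \<Longrightarrow> f p \<in> D \<and> R p (f p)"
    using assms(2) by metis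
  then have "inj_on f P"
    by (intro inj_onI) (metis assms(3))
  then show ?thesis
    using f assms(1) by (intro card_inj_on_le[of f]) auto
qed

text \<open>A dominating set meets the closed neighbourhood of every element of \<open>P\<close>,
  and these neighbourhoods are disjoint.\<close>

lemma packing_le_domination_number:
  assumes "finite (pverts G)" "P \<subseteq> pverts G"
    and "\<And>p q z. p \<in> P \<Longrightarrow> q \<in> P \<Longrightarrow> z = p \<or> (p, z) \<in> parcs G \<Longrightarrow>
      z = q \<or> (q, z) \<in> parcs G \<Longrightarrow> p = q"
  shows "card P \<le> domination_number G"
proof -
  obtain D where D: "dominating_set G D" "card D \<le> domination_number G"
    using domination_number_le_iff by blast
  have "card P \<le> card D"
  proof (rule card_le_if_common_witness_unique)
    show "finite D"
      using D(1) assms(1) by (auto simp: dominating_set_def intro: finite_subset)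
    show "\<exists>d\<in>D. d = p \<or> (p, d) \<in> parcs G" if "p \<in> P" for p
      using that D(1) assms(2) by (auto simp: dominating_set_def)
  qed (use assms(3) in blast)
  then show ?thesis using D(2) by simp
qed

lemma ball_Diff_iff: "(\<forall>x\<in>A - B. P x) \<longleftrightarrow> (\<forall>x\<in>A. x \<in> B \<or> P x)"
  by blast

text \<open>Old vertices \<open>D\<close> and new vertices \<open>X\<close> are separated: old
  vertices see each other only along edges outside \<open>F\<close>, and no two new vertices are
  adjacent.\<close>

lemma dominating_set_subdivide_edges:
  assumes "F \<subseteq> edges G" "D \<subseteq> pverts G" "X \<subseteq> F"
  shows "dominating_set (subdivide_edges G F) (Inl ` D \<union> Inr ` X) \<longleftrightarrow>
    (\<forall>v\<in>pverts G. v \<in> D \<or> (\<exists>w\<in>D. (v, w) \<in> parcs G \<and> {v, w} \<notin> F) \<or> (\<exists>e\<in>X. v \<in> e)) \<and>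
    (\<forall>e\<in>F. e \<in> X \<or> e \<inter> D \<noteq> {})"
proof -
  have "dominating_set (subdivide_edges G F) (Inl ` D \<union> Inr ` X) \<longleftrightarrow>
    (\<forall>v\<in>pverts G - D. \<exists>u\<in>Inl ` D \<union> Inr ` X. (Inl v, u) \<in> parcs (subdivide_edges G F)) \<and>
    (\<forall>e\<in>F - X. \<exists>u\<in>Inl ` D \<union> Inr ` X. (Inr e, u) \<in> parcs (subdivide_edges G F))"
  proof -
    have "pverts (subdivide_edges G F) - (Inl ` D \<union> Inr ` X) = Inl ` (pverts G - D) \<union> Inr ` (F - X)"
      by (auto simp: subdivide_edges_def)
    moreover have "Inl ` D \<union> Inr ` X \<subseteq> pverts (subdivide_edges G F)"
      using assms by (auto simp: subdivide_edges_def)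
    ultimately show ?thesis
      unfolding dominating_set_def by (simp only: ball_Un ball_simps simp_thms)
  qed
  also have "\<dots> \<longleftrightarrow> 
    (\<forall>v\<in>pverts G - D. (\<exists>w\<in>D. (v, w) \<in> parcs G \<and> {v, w} \<notin> F) \<or> (\<exists>e\<in>X. v \<in> e)) \<and>
    (\<forall>e\<in>F - X. e \<inter> D \<noteq> {})"
    using assms(3) by (intro arg_cong2[of _ _ _ _ "(\<and>)"] ball_cong refl)
      (auto simp: subdivide_edges_def)
  finally show ?thesis by (simp only: ball_Diff_iff)
qed

lemma sum_set_decomp: "S = Inl ` (Inl -` S) \<union> Inr ` (Inr -` S)"
  by (auto simp: image_iff) (metis sum.exhaust)

lemma card_sum_set:
  assumes "finite D" "finite X"
  shows "card (Inl ` D \<union> Inr ` X) = card D + card X"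
proof -
  have "card (Inl ` D \<union> Inr ` X) = card (D <+> X)"
    by (simp add: Plus_def)
  then show ?thesis
    using assms by (simp add: card_Plus)
qed

lemma domination_number_subdivide_edges_le_iff:
  assumes "finite (pverts G)" "finite F" "F \<subseteq> edges G"
  shows "domination_number (subdivide_edges G F) \<le> k \<longleftrightarrow> (\<exists>D X. D \<subseteq> pverts G \<and> X \<subseteq> F \<and>
    card D + card X \<le> k \<and>
    (\<forall>v\<in>pverts G. v \<in> D \<or> (\<exists>w\<in>D. (v, w) \<in> parcs G \<and> {v, w} \<notin> F) \<or> (\<exists>e\<in>X. v \<in> e)) \<and>
    (\<forall>e\<in>F. e \<in> X \<or> e \<inter> D \<noteq> {}))" (is "?L \<longleftrightarrow> ?R")
proof
  assume ?L
  then obtain S where S: "dominating_set (subdivide_edges G F) S" "card S \<le> k"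
    by (auto simp: domination_number_le_iff)
  define D where "D = Inl -` S"
  define X where "X = Inr -` S"
  have S_eq: "S = Inl ` D \<union> Inr ` X"
    unfolding D_def X_def by (rule sum_set_decomp)
  have sub: "D \<subseteq> pverts G" "X \<subseteq> F"
    using S(1) by (auto simp: D_def X_def dominating_set_def subdivide_edges_def)
  have "finite D" "finite X"
    using sub assms by (auto intro: finite_subset)
  then have "card D + card X \<le> k"
    using S(2) card_sum_set unfolding S_eq by metis
  then show ?R
    using S(1) sub unfolding S_eq dominating_set_subdivide_edges[OF assms(3) sub] by blast
next
  have "?R \<longleftrightarrow> (\<exists>D X. D \<subseteq> pverts G \<and> X \<subseteq> F \<and> card D + card X \<le> k \<and>
      dominating_set (subdivide_edges G F) (Inl ` D \<union> Inr ` X))"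
    by (rule ex_cong1, rule ex_cong1, intro conj_cong refl, rule dominating_set_subdivide_edges[OF assms(3), symmetric]) assumption+
  moreover assume ?R
  ultimately have "\<exists>D X. D \<subseteq> pverts G \<and> X \<subseteq> F \<and> card D + card X \<le> k \<and>
      dominating_set (subdivide_edges G F) (Inl ` D \<union> Inr ` X)"
    by (rule iffD1)
  then obtain D X where DX: "D \<subseteq> pverts G" "X \<subseteq> F" "card D + card X \<le> k"
    "dominating_set (subdivide_edges G F) (Inl ` D \<union> Inr ` X)"
    by (elim exE conjE)
  moreover have "finite D" "finite X"
    using DX(1,2) assms by (auto intro: finite_subset)
  then have "card (Inl ` D \<union> Inr ` X) = card D + card X"
    by (rule card_sum_set)
  ultimately show ?L
    by (metis domination_number_le_iff)
qed

lemma dominating_set_subdivide_path: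
  assumes "D \<subseteq> pverts G" "X \<subseteq> {1..t}" "t \<ge> 1"
  shows "dominating_set (subdivide_path G u v t) (Inl ` D \<union> Inr ` X) \<longleftrightarrow>
    (\<forall>a\<in>pverts G. a \<in> D \<or> (\<exists>b\<in>D. (a, b) \<in> parcs G \<and> {a, b} \<noteq> {u, v}) \<or>
      a = u \<and> 1 \<in> X \<or> a = v \<and> t \<in> X) \<and>
    (\<forall>i\<in>{1..t}. i \<in> X \<or> i = 1 \<and> u \<in> D \<or> i = t \<and> v \<in> D \<or> i < t \<and> Suc i \<in> X \<or> i > 1 \<and> i - 1 \<in> X)"
proof -
  let ?H = "subdivide_path G u v t"
  have "dominating_set ?H (Inl ` D \<union> Inr ` X) \<longleftrightarrow>
    (\<forall>a\<in>pverts G - D. \<exists>z\<in>Inl ` D \<union> Inr ` X. (Inl a, z) \<in> parcs ?H) \<and>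
    (\<forall>i\<in>{1..t} - X. \<exists>z\<in>Inl ` D \<union> Inr ` X. (Inr i, z) \<in> parcs ?H)"
  proof -
    have "pverts ?H - (Inl ` D \<union> Inr ` X) = Inl ` (pverts G - D) \<union> Inr ` ({1..t} - X)"
      by (auto simp: subdivide_path_def Let_def)
    moreover have "Inl ` D \<union> Inr ` X \<subseteq> pverts ?H"
      using assms by (auto simp: subdivide_path_def Let_def)
    ultimately show ?thesis
      unfolding dominating_set_def by (simp only: ball_Un ball_simps simp_thms)
  qed
  also have "\<dots> \<longleftrightarrow> 
    (\<forall>a\<in>pverts G - D. (\<exists>b\<in>D. (a, b) \<in> parcs G \<and> {a, b} \<noteq> {u, v}) \<or>
      a = u \<and> 1 \<in> X \<or> a = v \<and> t \<in> X) \<and>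
    (\<forall>i\<in>{1..t} - X. i = 1 \<and> u \<in> D \<or> i = t \<and> v \<in> D \<or> i < t \<and> Suc i \<in> X \<or> i > 1 \<and> i - 1 \<in> X)"
  proof (intro arg_cong2[of _ _ _ _ "(\<and>)"] ball_cong refl)
    show "(\<exists>z\<in>Inl ` D \<union> Inr ` X. (Inl a, z) \<in> parcs ?H) \<longleftrightarrow>
      (\<exists>b\<in>D. (a, b) \<in> parcs G \<and> {a, b} \<noteq> {u, v}) \<or> a = u \<and> 1 \<in> X \<or> a = v \<and> t \<in> X" for a
      by (auto simp: subdivide_path_def Let_def)
    show "(\<exists>z\<in>Inl ` D \<union> Inr ` X. (Inr i, z) \<in> parcs ?H) \<longleftrightarrow>
      i = 1 \<and> u \<in> D \<or> i = t \<and> v \<in> D \<or> i < t \<and> Suc i \<in> X \<or> i > 1 \<and> i - 1 \<in> X"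
      if "i \<in> {1..t} - X" for i
    proof -
      have "(Inr i, Inr j) \<in> parcs ?H \<longleftrightarrow> i < t \<and> j = Suc i \<or> i > 1 \<and> j = i - 1" for j
        using that by (auto simp: subdivide_path_def Let_def)
      moreover have "(Inr i, Inl a) \<in> parcs ?H \<longleftrightarrow> i = 1 \<and> a = u \<or> i = t \<and> a = v" for a
        using that by (auto simp: subdivide_path_def Let_def)
      ultimately show ?thesis
        by (auto simp: bex_Un)
    qed
  qed
  finally show ?thesis by (simp only: ball_Diff_iff)
qed

lemma domination_number_subdivide_path_le_iff:
  assumes "finite (pverts G)" "t \<ge> 1"
  shows "domination_number (subdivide_path G u v t) \<le> k \<longleftrightarrow>
    (\<exists>D X. D \<subseteq> pverts G \<and> X \<subseteq> {1..t} \<and> card D + card X \<le> k \<and>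
    (\<forall>a\<in>pverts G. a \<in> D \<or> (\<exists>b\<in>D. (a, b) \<in> parcs G \<and> {a, b} \<noteq> {u, v}) \<or>
      a = u \<and> 1 \<in> X \<or> a = v \<and> t \<in> X) \<and>
    (\<forall>i\<in>{1..t}. i \<in> X \<or> i = 1 \<and> u \<in> D \<or> i = t \<and> v \<in> D \<or> i < t \<and> Suc i \<in> X \<or> i > 1 \<and> i - 1 \<in> X))"
    (is "?L \<longleftrightarrow> ?R")
proof
  assume ?L
  then obtain S where S: "dominating_set (subdivide_path G u v t) S" "card S \<le> k"
    by (auto simp: domination_number_le_iff)
  define D where "D = Inl -` S"
  define X where "X = Inr -` S"
  have S_eq: "S = Inl ` D \<union> Inr ` X"
    unfolding D_def X_def by (rule sum_set_decomp)
  have sub: "D \<subseteq> pverts G" "X \<subseteq> {1..t}"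
    using S(1) by (auto simp: D_def X_def dominating_set_def subdivide_path_def Let_def)
  have "finite D" "finite X"
    using sub assms by (auto intro: finite_subset)
  then have "card D + card X \<le> k"
    using S(2) card_sum_set unfolding S_eq by metis
  then show ?R
    using S(1) sub unfolding S_eq dominating_set_subdivide_path[OF sub assms(2)] by blast
next
  have "?R \<longleftrightarrow> (\<exists>D X. D \<subseteq> pverts G \<and> X \<subseteq> {1..t} \<and> card D + card X \<le> k \<and>
      dominating_set (subdivide_path G u v t) (Inl ` D \<union> Inr ` X))"
    by (rule ex_cong1, rule ex_cong1, intro conj_cong refl, rule dominating_set_subdivide_path[OF _ _ assms(2), symmetric]) assumption+
  moreover assume ?R
  ultimately have "\<exists>D X. D \<subseteq> pverts G \<and> X \<subseteq> {1..t} \<and> card D + card X \<le> k \<and>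
      dominating_set (subdivide_path G u v t) (Inl ` D \<union> Inr ` X)"
    by (rule iffD1)
  then obtain D X where DX: "D \<subseteq> pverts G" "X \<subseteq> {1..t}" "card D + card X \<le> k"
    "dominating_set (subdivide_path G u v t) (Inl ` D \<union> Inr ` X)"
    by (elim exE conjE)
  moreover have "finite D" "finite X"
    using DX(1,2) assms by (auto intro: finite_subset)
  then have "card (Inl ` D \<union> Inr ` X) = card D + card X"
    by (rule card_sum_set)
  ultimately show ?L
    by (metis domination_number_le_iff)
qed

text \<open>The two encodings impose the same conditions on the old vertices, so both numbers admit
  the same bounds \<open>k\<close>; this replaces an explicit isomorphism.\<close>

lemma domination_number_subdivide_path_1:
  assumes "finite (pverts G)" "(u, v) \<in> parcs G"
  shows "domination_number (subdivide_path G u v 1) = domination_number (subdivide_edges G {{u, v}})"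
proof -
  \<comment> \<open>The new vertices have different types in the two graphs, so \<open>X\<close> is
    eliminated: a subset of a singleton is empty or full.\<close>
  have singleton: "(\<exists>X. A \<and> X \<subseteq> {e} \<and> Q X) \<longleftrightarrow> A \<and> (Q {} \<or> Q {e})" for A e and Q :: "'c set \<Rightarrow> bool"
    by (auto simp: subset_singleton_iff)
  have F: "{{u, v}} \<subseteq> edges G" 
    using assms(2) by (auto simp: edges_def)
  have "domination_number (subdivide_path G u v 1) \<le> k \<longleftrightarrow>
    domination_number (subdivide_edges G {{u, v}}) \<le> k" for k
    unfolding domination_number_subdivide_edges_le_iff[OF assms(1) finite.insertI[OF finite.emptyI] F]
      domination_number_subdivide_path_le_iff[OF assms(1) order.refl] atLeastAtMost_singleton
    unfolding singleton by (rule ex_cong1) auto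
  then show ?thesis
    by (metis order.antisym order.refl)
qed

section \<open>The two sides of an edge of a tree\<close>

locale undirected_tree_graph =
  fixes T :: "'a pair_pre_digraph"
  assumes undirected_tree: "undirected_tree T"
begin

abbreviation "V \<equiv> pverts T"
abbreviation "E \<equiv> parcs T"
abbreviation "\<gamma> \<equiv> domination_number T"

sublocale pair_graph T
  using undirected_tree by (simp add: undirected_tree_def)

lemma sym_E: "(x, y) \<in> E \<Longrightarrow> (y, x) \<in> E"
  by (rule arcs_symmetric)

lemma reachable_E: "x \<in> V \<Longrightarrow> y \<in> V \<Longrightarrow> (x, y) \<in> E\<^sup>*"
proof -
  assume xy: "x \<in> V" "y \<in> V"
  have "strongly_connected (with_proj (mk_symmetric (with_proj T)))"
    using undirected_tree by (simp add: undirected_tree_def connected_def)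
  then have "x \<rightarrow>\<^sup>*\<^bsub>with_proj (mk_symmetric (with_proj T))\<^esub> y"
    using xy by (auto simp: strongly_connected_def)
  then have "x \<rightarrow>\<^sup>*\<^bsub>with_proj T\<^esub> y"
    using reachable_mk_symmetric_eq pair_sym_arcs by blast
  then show ?thesis
    by (auto simp: reachable_def intro: rtrancl_on_rtranclI)
qed

lemma pawalk_verts_snoc: "pcas u p v \<Longrightarrow> pawalk_verts u (p @ [(v, w)]) = pawalk_verts u p @ [w]"
  by (induction p arbitrary: u) auto

text \<open>A second route would contain a path from \<open>u\<close> to \<open>v\<close>, of length
  at least 2 because the arc \<open>(u, v)\<close> is removed; the arc \<open>(v, u)\<close> closes
  it to a forbidden cycle.\<close>

lemma bridge:
  assumes "(u, v) \<in> E"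
  shows "(u, v) \<notin> (E - {(u, v), (v, u)})\<^sup>*"
proof
  define H where "H = \<lparr>pverts = V, parcs = E - {(u, v), (v, u)}\<rparr>"
  interpret H: pair_wf_digraph H
    by unfold_locales (auto simp: H_def wellformed')
  assume "(u, v) \<in> (E - {(u, v), (v, u)})\<^sup>*"
  then have "(u, v) \<in> rtrancl_on V (parcs H)"
  proof (induction rule: rtrancl_induct)
    case base
    then show ?case using assms wellformed' by auto
  next
    case (step y z)
    then show ?case
      using wellformed' by (auto simp: H_def intro: rtrancl_on_into_rtrancl_on)
  qed
  then have "u \<rightarrow>\<^sup>*\<^bsub>with_proj H\<^esub> v"
    by (simp add: reachable_def H_def)
  then obtain p where "H.apath u p v"
    using H.reachable_apath by blast
  moreover have "parcs H = E - {(u, v), (v, u)}"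
    by (simp add: H_def)
  ultimately have p: "set p \<subseteq> E - {(u, v), (v, u)}" "pcas u p v" "distinct (pawalk_verts u p)"
    by (auto simp: H.apath_def H.awalk_def)
  have "length p \<ge> 2"
    using p assms no_loops'[of u v] by (cases p; cases "tl p") auto
  moreover obtain vs where "pawalk_verts u p = u # vs"
    using p(2) by (cases p) auto
  then have "distinct (tl (pawalk_verts u (p @ [(v, u)])))"
    using p(3) pawalk_verts_snoc[OF p(2)] by simp
  moreover have "pcas u (p @ [(v, u)]) u"
    using p(2) by (induction p arbitrary: u) auto
  ultimately have "cycle (p @ [(v, u)]) \<and> length (p @ [(v, u)]) \<ge> 3"
    using p(1) assms sym_E wellformed' unfolding cycle_def awalk_def by auto
  then show False
    using undirected_tree unfolding undirected_tree_def by blast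
qed

text \<open>For an edge \<open>uv\<close> this is the component of \<open>u\<close> after the edge
  is removed.\<close>

definition side :: "'a \<Rightarrow> 'a \<Rightarrow> 'a set" where
  "side u v = {x. (u, x) \<in> (E - {(u, v), (v, u)})\<^sup>*}"

lemma side_self [simp]: "u \<in> side u v"
  by (simp add: side_def)

lemma side_other: "(u, v) \<in> E \<Longrightarrow> v \<notin> side u v"
  using bridge by (simp add: side_def)

text \<open>The bridge is the only way out of a side. Most later separation arguments use the tree
  structure through this fact.\<close>

lemma side_step:
  assumes "(u, v) \<in> E" "x \<in> side u v" "(x, y) \<in> E"
  shows "y \<in> side u v \<or> x = u \<and> y = v"
proof (cases "(x, y) \<in> {(u, v), (v, u)}")
  case True
  then show ?thesis using side_other assms by auto
next
  case False
  then show ?thesis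
    using assms unfolding side_def by (simp add: rtrancl.rtrancl_into_rtrancl)
qed

lemma side_subsetI:
  assumes "u \<in> Z" "\<And>x y. x \<in> Z \<Longrightarrow> x \<in> side u v \<Longrightarrow> (x, y) \<in> E \<Longrightarrow> (x, y) \<noteq> (u, v) \<Longrightarrow> y \<in> Z"
  shows "side u v \<subseteq> Z"
proof
  fix x assume "x \<in> side u v"
  then have "(u, x) \<in> (E - {(u, v), (v, u)})\<^sup>*" 
    by (simp add: side_def)
  then have "x \<in> Z \<and> x \<in> side u v"
  proof (induction rule: rtrancl_induct)
    case base
    then show ?case using assms by simp
  next
    case (step y z)
    then show ?case
      using assms(2)[of y z] by (auto simp: side_def intro: rtrancl_into_rtrancl)
  qed
  then show "x \<in> Z" by simp
qed

lemma side_subset: "u \<in> V \<Longrightarrow> side u v \<subseteq> V"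
  by (rule side_subsetI) (auto simp: wellformed')

lemma side_compl:
  assumes uv: "(u, v) \<in> E"
  shows "V - side u v = side v u"
proof
  show "side v u \<subseteq> V - side u v"
  proof (rule side_subsetI)
    show "v \<in> V - side u v"
      using uv side_other wellformed' by auto
    fix x y assume "x \<in> V - side u v" "(x, y) \<in> E" "(x, y) \<noteq> (v, u)"
    then show "y \<in> V - side u v"
      using side_step[OF uv, of y x] sym_E wellformed' by auto
  qed
  have "x \<in> side u v \<union> side v u" if "(u, x) \<in> E\<^sup>*" for x
    using that
  proof (induction rule: rtrancl_induct)
    case (step y z)
    then show ?case
      using side_step[OF uv, of y z] side_step[OF sym_E[OF uv], of y z] by auto
  qed simp
  then show "V - side u v \<subseteq> side v u"
    using reachable_E uv wellformed' by blast
qed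

lemma side_iff: "(u, v) \<in> E \<Longrightarrow> x \<in> V \<Longrightarrow> x \<in> side v u \<longleftrightarrow> x \<notin> side u v"
  using side_compl by blast

lemma side_disjoint: 
  assumes "(u, v) \<in> E" 
  shows "side u v \<inter> side v u = {}"
  using side_compl[OF assms] by blast

text \<open>The branch at \<open>d\<close> never passes through \<open>w\<close>, so it lies in the
  side of \<open>w\<close> at the edge \<open>wc\<close>.\<close>

lemma side_branches_disjoint:
  assumes "(w, c) \<in> E" "(w, d) \<in> E" "c \<noteq> d"
  shows "side c w \<inter> side d w = {}"
proof -
  have "w \<notin> side d w"
    using assms sym_E side_other by blast
  then have "side d w \<subseteq> side w c"
    using assms side_step[of w c w d] side_step[of w c]
    by (intro side_subsetI) auto
  then show ?thesis
    using side_disjoint[OF assms(1)] by blast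
qed

lemma side_branches:
  assumes "w \<in> V"
  shows "V - {w} = (\<Union>c\<in>{c. (w, c) \<in> E}. side c w)"
proof
  have "x = w \<or> (\<exists>c. (w, c) \<in> E \<and> x \<in> side c w)" if "(w, x) \<in> E\<^sup>*" for x
    using that
  proof (induction rule: rtrancl_induct)
    case (step y z)
    then show ?case
      using side_step[of _ w y z] sym_E side_self by metis
  qed simp
  then show "V - {w} \<subseteq> (\<Union>c\<in>{c. (w, c) \<in> E}. side c w)"
    using reachable_E assms by blast
  show "(\<Union>c\<in>{c. (w, c) \<in> E}. side c w) \<subseteq> V - {w}"
    using side_subset side_other sym_E wellformed' by blast
qed

lemma card_side:
  assumes "(u, v) \<in> E" "D \<subseteq> V"
  shows "card D = card (D \<inter> side u v) + card (D \<inter> side v u)"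
proof -
  have "D = (D \<inter> side u v) \<union> (D \<inter> side v u)"
    using side_compl[OF assms(1)] assms(2) by blast
  moreover have "finite D"
    using assms(2) pair_finite_verts finite_subset by blast
  ultimately show ?thesis
    using side_disjoint[OF assms(1)] by (metis card_Un_disjoint finite_Int inf_commute inf_bot_right inf_left_commute)
qed

section \<open>Domination of vertex subsets\<close>

definition covers :: "'a set \<Rightarrow> 'a set \<Rightarrow> bool" where
  "covers D X \<longleftrightarrow> (\<forall>x\<in>X. x \<in> D \<or> (\<exists>y\<in>D. (x, y) \<in> E))"

lemma covers_mono: "covers D X \<Longrightarrow> D \<subseteq> D' \<Longrightarrow> X' \<subseteq> X \<Longrightarrow> covers D' X'"
  unfolding covers_def by blast

lemma covers_Un: "covers D X \<Longrightarrow> covers D' X' \<Longrightarrow> covers (D \<union> D') (X \<union> X')"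
  unfolding covers_def by blast

text \<open>Within its side only \<open>u\<close> can be dominated from outside, and only by
  \<open>v\<close>. The last premise excludes this case, so restricting \<open>D\<close> to the side
  loses nothing.\<close>

lemma covers_side:
  assumes "covers D X" "(u, v) \<in> E" "Y \<subseteq> X" "Y \<subseteq> side u v" "u \<in> Y \<Longrightarrow> v \<in> D \<Longrightarrow> u \<in> D"
  shows "covers (D \<inter> side u v) Y"
  using assms side_step[OF assms(2)] unfolding covers_def by (metis IntI subsetD)

lemma domination_number_le: "D \<subseteq> V \<Longrightarrow> covers D V \<Longrightarrow> \<gamma> \<le> card D"
  using domination_number_le_iff[of T "card D"] unfolding dominating_set_def covers_def by blast

lemma minimum_dominating_set: obtains D where "D \<subseteq> V" "covers D V" "card D \<le> \<gamma>"
  using domination_number_le_iff[of T "\<gamma>"] unfolding dominating_set_def covers_def by blast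

lemma finite_verts_subset: "D \<subseteq> V \<Longrightarrow> finite D"
  using pair_finite_verts finite_subset by blast

section \<open>Critical vertices\<close>

text \<open>Equivalently, deleting \<open>u\<close> from the tree lowers the domination
  number.\<close>

definition critical :: "'a \<Rightarrow> bool" where
  "critical u \<longleftrightarrow> u \<in> V \<and> (\<exists>D\<subseteq>V. covers D (V - {u}) \<and> card D < \<gamma>)"

text \<open>A set with fewer than \<open>\<gamma>\<close> vertices cannot dominate \<open>u\<close>
  as well, so it misses the whole closed neighbourhood of \<open>u\<close>.\<close>

lemma criticalE:
  assumes "critical u"
  obtains D where "D \<subseteq> V" "covers D (V - {u})" "card D < \<gamma>" "u \<notin> D" "\<And>y. (u, y) \<in> E \<Longrightarrow> y \<notin> D"
proof -
  obtain D where D: "D \<subseteq> V" "covers D (V - {u})" "card D < \<gamma>"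
    using assms unfolding critical_def by blast
  moreover have "\<not> covers D V"
    using D(3) domination_number_le[OF D(1)] by linarith
  then have "u \<notin> D \<and> (\<forall>y. (u, y) \<in> E \<longrightarrow> y \<notin> D)"
    using D(2) unfolding covers_def by blast
  ultimately show ?thesis using that by blast
qed

text \<open>The exchange argument: if \<open>P\<close> and \<open>Q\<close> both have fewer than
  \<open>\<gamma>\<close> vertices, the two recombined sets cannot have at least
  \<open>\<gamma>\<close> and \<open>\<gamma> - 1\<close> vertices.\<close>

lemma card_exchange:
  assumes "(u, v) \<in> E" "P \<subseteq> V" "Q \<subseteq> V"
  shows "card (P \<inter> side u v \<union> Q \<inter> side v u) + card (P \<inter> side v u \<union> Q \<inter> side u v) = card P + card Q"
proof -
  have "card (X \<inter> side u v \<union> Y \<inter> side v u) = card (X \<inter> side u v) + card (Y \<inter> side v u)"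
    if "X \<subseteq> V" "Y \<subseteq> V" for X Y
    using that side_disjoint[OF assms(1)] finite_verts_subset by (intro card_Un_disjoint) auto
  then show ?thesis
    using assms card_side[OF assms(1)] by (simp add: Un_commute[of "_ \<inter> side v u"])
qed

text \<open>Witnesses \<open>P\<close> for \<open>u\<close> and \<open>Q\<close> for
  \<open>v\<close> are exchanged across \<open>uv\<close>. Each is flawless on the side away from
  its own vertex, so one recombination dominates everything; the other misses only \<open>u\<close>
  and \<open>v\<close>, and adding \<open>u\<close> repairs both.\<close>

lemma critical_not_adjacent:
  assumes "critical u" "critical v" shows "(u, v) \<notin> E"
proof
  assume uv: "(u, v) \<in> E"
  let ?U = "side u v" and ?W = "side v u"
  note vu = sym_E[OF uv] and VU = side_compl[OF uv] and sub = side_subset[of u v] side_subset[of v u]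
  have uV: "u \<in> V" "v \<in> V" using uv wellformed' by auto
  obtain P where P: "P \<subseteq> V" "covers P (V - {u})" "card P < \<gamma>" "u \<notin> P" "\<And>y. (u, y) \<in> E \<Longrightarrow> y \<notin> P"
    using criticalE[OF assms(1)] by metis
  obtain Q where Q: "Q \<subseteq> V" "covers Q (V - {v})" "card Q < \<gamma>" "v \<notin> Q" "\<And>y. (v, y) \<in> E \<Longrightarrow> y \<notin> Q"
    using criticalE[OF assms(2)] by metis
  have "covers (P \<inter> ?W) ?W" 
    using P sub uV vu side_other by (intro covers_side[OF P(2) vu]) auto
  moreover have "covers (Q \<inter> ?U) ?U" 
    using Q sub uV uv side_other by (intro covers_side[OF Q(2) uv]) auto
  ultimately have "covers (P \<inter> ?W \<union> Q \<inter> ?U) (?W \<union> ?U)"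
    by (rule covers_Un)
  moreover have "?W \<union> ?U = V"
    using VU sub uV by blast
  ultimately have "covers (P \<inter> ?W \<union> Q \<inter> ?U) V"
    by simp
  then have 1: "\<gamma> \<le> card (P \<inter> ?W \<union> Q \<inter> ?U)"
    using P Q by (intro domination_number_le) auto
  have "covers (P \<inter> ?U) (?U - {u})" 
    using P sub uV uv by (intro covers_side[OF P(2) uv]) auto
  moreover have "covers (Q \<inter> ?W) (?W - {v})" 
    using Q sub uV vu by (intro covers_side[OF Q(2) vu]) auto
  ultimately have "covers (P \<inter> ?U \<union> Q \<inter> ?W) ((?U - {u}) \<union> (?W - {v}))"
    by (rule covers_Un)
  then have "covers (insert u (P \<inter> ?U \<union> Q \<inter> ?W)) V"
    using VU vu unfolding covers_def by blast
  then have 2: "\<gamma> \<le> card (insert u (P \<inter> ?U \<union> Q \<inter> ?W))"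
    using P Q uV by (intro domination_number_le) auto
  have "card (insert u (P \<inter> ?U \<union> Q \<inter> ?W)) \<le> Suc (card (P \<inter> ?U \<union> Q \<inter> ?W))"
    by (rule card_insert_le_m1) auto
  then show False
    using 1 2 P(3) Q(3) card_exchange[OF uv P(1) Q(1)] by linarith
qed

text \<open>The same exchange, now across \<open>uw\<close>, with \<open>v\<close> on the side of
  \<open>w\<close>. One recombination may miss \<open>u\<close>, \<open>v\<close> and
  \<open>w\<close>, all repaired by \<open>w\<close>. The other is complete because
  \<open>w\<close>, a neighbour of \<open>v\<close>, is not in \<open>Q\<close>.\<close>

lemma critical_no_common_neighbour:
  assumes "critical u" "critical v" "(u, w) \<in> E" "(v, w) \<in> E"
  shows "u = v"
proof (rule ccontr)
  assume "u \<noteq> v"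
  let ?U = "side u w" and ?W = "side w u"
  note uw = assms(3)
  note wu = sym_E[OF uw] and VU = side_compl[OF uw] and sub = side_subset[of u w] side_subset[of w u]
  have uV: "u \<in> V" "v \<in> V" "w \<in> V" using assms wellformed' by auto
  obtain P where P: "P \<subseteq> V" "covers P (V - {u})" "card P < \<gamma>" "u \<notin> P" "\<And>y. (u, y) \<in> E \<Longrightarrow> y \<notin> P"
    using criticalE[OF assms(1)] by metis
  obtain Q where Q: "Q \<subseteq> V" "covers Q (V - {v})" "card Q < \<gamma>" "v \<notin> Q" "\<And>y. (v, y) \<in> E \<Longrightarrow> y \<notin> Q"
    using criticalE[OF assms(2)] by metis
  have vW: "v \<in> ?W"
    using side_step[OF wu side_self sym_E[OF assms(4)]] \<open>u \<noteq> v\<close> by blast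
  have "covers (P \<inter> ?W) ?W" 
    using P sub uV wu side_other by (intro covers_side[OF P(2) wu]) auto
  moreover have "covers (Q \<inter> ?U) ?U" 
    using Q(5)[OF assms(4)] sub uV vW VU by (intro covers_side[OF Q(2) uw]) auto
  ultimately have "covers (P \<inter> ?W \<union> Q \<inter> ?U) (?W \<union> ?U)"
    by (rule covers_Un)
  moreover have "?W \<union> ?U = V"
    using VU sub uV by blast
  ultimately have "covers (P \<inter> ?W \<union> Q \<inter> ?U) V"
    by simp
  then have 1: "\<gamma> \<le> card (P \<inter> ?W \<union> Q \<inter> ?U)"
    using P Q by (intro domination_number_le) auto
  have "covers (P \<inter> ?U) (?U - {u})" 
    using P sub uV uw by (intro covers_side[OF P(2) uw]) auto
  moreover have "covers (Q \<inter> ?W) (?W - {v, w})" 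
    using Q sub uV wu by (intro covers_side[OF Q(2) wu]) auto
  ultimately have "covers (P \<inter> ?U \<union> Q \<inter> ?W) ((?U - {u}) \<union> (?W - {v, w}))"
    by (rule covers_Un)
  then have "covers (insert w (P \<inter> ?U \<union> Q \<inter> ?W)) V"
    using VU assms(3,4) unfolding covers_def by blast
  then have 2: "\<gamma> \<le> card (insert w (P \<inter> ?U \<union> Q \<inter> ?W))"
    using P Q uV by (intro domination_number_le) auto
  have "card (insert w (P \<inter> ?U \<union> Q \<inter> ?W)) \<le> Suc (card (P \<inter> ?U \<union> Q \<inter> ?W))"
    by (rule card_insert_le_m1) auto
  then show False
    using 1 2 P(3) Q(3) card_exchange[OF uw P(1) Q(1)] by linarith
qed

section \<open>The critical vertices as a packing\<close>

abbreviation "A \<equiv> Collect critical"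

lemma critical_subset: "A \<subseteq> V"
  by (auto simp: critical_def)

text \<open>By the two exchange lemmas the closed neighbourhoods of critical vertices are disjoint,
  so each element of \<open>Y\<close> needs its own dominator. The form with a subset
  \<open>Y\<close> allows counting on one side of an edge.\<close>

lemma card_critical_le:
  assumes "Y \<subseteq> A" "D \<subseteq> V" "covers D Y"
  shows "card Y \<le> card D"
proof (rule card_le_if_common_witness_unique)
  show "finite D" using assms(2) by (rule finite_verts_subset)
  show "\<exists>d\<in>D. d = p \<or> (p, d) \<in> E" if "p \<in> Y" for p
    using that assms(3) unfolding covers_def by blast
  show "p = q" if "p \<in> Y" "q \<in> Y" "d = p \<or> (p, d) \<in> E" "d = q \<or> (q, d) \<in> E" for p q d
    using that assms(1) critical_not_adjacent critical_no_common_neighbour by blast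
qed

lemma domination_number_eq_card_critical:
  assumes "covers A V" shows "\<gamma> = card A"
proof (rule antisym)
  show "\<gamma> \<le> card A"
    using assms critical_subset by (rule domination_number_le[rotated])
  show "card A \<le> \<gamma>"
    using minimum_dominating_set card_critical_le critical_subset covers_mono
    by (metis order.refl order_trans)
qed

section \<open>Trees dominated by their critical vertices\<close>

text \<open>
  \<open>D\<close> replaces \<open>A \<inter> side u v\<close> when \<open>uv\<close> is subdivided.  For critical \<open>u\<close>, the strict inequality
  leaves room for the new vertex on \<open>uv\<close>, which then dominates \<open>u\<close>.
\<close>

definition branch_set :: "'a \<Rightarrow> 'a \<Rightarrow> 'a set \<Rightarrow> bool" where
  "branch_set u v D \<longleftrightarrow> D \<subseteq> side u v \<and>
    (if critical u then covers D (side u v - {u}) \<and> card D < card (A \<inter> side u v)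
     else covers D (side u v) \<and> (u \<in> D \<or> critical v) \<and> card D \<le> card (A \<inter> side u v))"

text \<open>The set is cut from a witness for a critical vertex near \<open>u\<close>:
  \<open>u\<close> itself, else \<open>v\<close>, else a critical neighbour of \<open>u\<close>.
  Since \<open>A\<close> is a packing, the witness saves nothing on the other side in the first and
  third case, so the saving falls on this side. If \<open>v\<close> is critical, the other side may
  save one vertex, and this side still costs no more than \<open>A\<close>.\<close>

lemma ex_branch_set:
  assumes A: "covers A V" and uv: "(u, v) \<in> E"
  shows "\<exists>D. branch_set u v D"
proof -
  let ?U = "side u v" and ?W = "side v u"
  note vu = sym_E[OF uv]
  have uV: "u \<in> V" "v \<in> V" using uv wellformed' by auto
  have UW: "?U \<subseteq> V" "?W \<subseteq> V" "u \<notin> ?W" "v \<notin> ?U" "?U \<inter> ?W = {}"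
    using uV side_subset side_other uv vu side_disjoint by auto
  have card_A: "\<gamma> = card (A \<inter> ?U) + card (A \<inter> ?W)"
    using domination_number_eq_card_critical[OF A] card_side[OF uv critical_subset] by simp
  show ?thesis
  proof (cases "critical u")
    case True
    then obtain P where P: "P \<subseteq> V" "covers P (V - {u})" "card P < \<gamma>" "u \<notin> P" "\<And>y. (u, y) \<in> E \<Longrightarrow> y \<notin> P"
      using criticalE by metis
    have "covers (P \<inter> ?U) (?U - {u})"
      using P UW by (intro covers_side[OF P(2) uv]) auto
    moreover have "covers (P \<inter> ?W) (A \<inter> ?W)"
      using P UW by (intro covers_side[OF P(2) vu]) auto
    then have "card (A \<inter> ?W) \<le> card (P \<inter> ?W)"
      using P(1) by (intro card_critical_le) auto
    then have "card (P \<inter> ?U) < card (A \<inter> ?U)"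
      using card_A card_side[OF uv P(1)] P(3) by linarith
    ultimately show ?thesis
      using True unfolding branch_set_def by (intro exI[of _ "P \<inter> ?U"]) auto
  next
    case u: False
    show ?thesis
    proof (cases "critical v")
      case True
      then obtain P where P: "P \<subseteq> V" "covers P (V - {v})" "card P < \<gamma>" "v \<notin> P" "\<And>y. (v, y) \<in> E \<Longrightarrow> y \<notin> P"
        using criticalE by metis
      have "covers (P \<inter> ?U) ?U"
        using P UW by (intro covers_side[OF P(2) uv]) auto
      moreover have "covers (P \<inter> ?W) (A \<inter> ?W - {v})"
        using P UW by (intro covers_side[OF P(2) vu]) auto
      then have "card (A \<inter> ?W - {v}) \<le> card (P \<inter> ?W)"
        using P(1) by (intro card_critical_le) auto
      then have "card (A \<inter> ?W) - 1 \<le> card (P \<inter> ?W)"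
        using True by (subst (asm) card_Diff_singleton) auto
      then have "card (P \<inter> ?U) \<le> card (A \<inter> ?U)"
        using card_A card_side[OF uv P(1)] P(3) by linarith
      ultimately show ?thesis
        using True u unfolding branch_set_def by (intro exI[of _ "P \<inter> ?U"]) auto
    next
      case v: False
      obtain a where a: "critical a" "(u, a) \<in> E"
        using A u uV unfolding covers_def by auto
      then obtain P where P: "P \<subseteq> V" "covers P (V - {a})" "card P < \<gamma>" "a \<notin> P" "\<And>y. (a, y) \<in> E \<Longrightarrow> y \<notin> P"
        using criticalE by metis
      have aU: "a \<in> ?U"
        using side_step[OF uv side_self a(2)] v a by blast
      have "u \<notin> P"
        using P(5) a sym_E by blast
      have "covers (P \<inter> ?U) (?U - {a, u})"
        using P UW by (intro covers_side[OF P(2) uv]) auto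
      \<comment> \<open>Adding \<open>u\<close> dominates the missing \<open>a\<close> and
        \<open>u\<close>; the count below pays for it with the vertex saved by the witness.\<close>
      then have "covers (insert u (P \<inter> ?U)) ?U"
        using a sym_E unfolding covers_def by blast
      moreover have "covers (P \<inter> ?W) (A \<inter> ?W)"
        using P UW aU \<open>u \<notin> P\<close> by (intro covers_side[OF P(2) vu]) auto
      then have "card (A \<inter> ?W) \<le> card (P \<inter> ?W)"
        using P(1) by (intro card_critical_le) auto
      then have "card (P \<inter> ?U) < card (A \<inter> ?U)"
        using card_A card_side[OF uv P(1)] P(3) by linarith
      then have "card (insert u (P \<inter> ?U)) \<le> card (A \<inter> ?U)"
        using \<open>u \<notin> P\<close> finite_verts_subset[OF P(1)] by simp
      ultimately show ?thesis
        using u unfolding branch_set_def by (intro exI[of _ "insert u (P \<inter> ?U)"]) auto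
    qed
  qed
qed

lemma branch_set_covers:
  assumes "branch_set u v D" "x \<in> side u v"
  shows "critical u \<and> x = u \<or> x \<in> D \<or> (\<exists>w\<in>D. (x, w) \<in> E)"
  using assms unfolding branch_set_def covers_def by (auto split: if_splits)

text \<open>
  The case of a single edge is included: there \<open>(q, p) = (v, u)\<close>.
\<close>

lemma domination_number_subdivide_disjoint_sides:
  assumes A: "covers A V" and uv: "(u, v) \<in> E" and qp: "(q, p) \<in> E"
    and disj: "side u v \<inter> side q p = {}"
  shows "domination_number (subdivide_edges T {{u, v}, {q, p}}) \<le> \<gamma>"
proof -
  let ?U = "side u v" and ?Q = "side q p"
  obtain Du Dq where D: "branch_set u v Du" "branch_set q p Dq"
    using ex_branch_set A uv qp by meson
  then have sub: "Du \<subseteq> ?U" "Dq \<subseteq> ?Q"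
    by (auto simp: branch_set_def)
  define M where "M = A - ?U - ?Q"
  define D where "D = Du \<union> Dq \<union> M"
  define X where "X = (if critical u then {{u, v}} else {}) \<union> (if critical q then {{q, p}} else {})"
  have V: "u \<in> V" "v \<in> V" "q \<in> V" "p \<in> V" 
    using uv qp wellformed' by auto
  then have UQ: "?U \<subseteq> V" "?Q \<subseteq> V" "q \<notin> ?U" "u \<notin> ?Q" "v \<notin> ?U" "p \<notin> ?Q"
    using side_subset disj side_self[of u v] side_self[of q p] side_other uv qp by blast+
  have DV: "D \<subseteq> V"
    using UQ sub critical_subset by (auto simp: D_def M_def)
  have edges: "{{u, v}, {q, p}} \<subseteq> edges T"
    using uv qp by (auto simp: edges_def)
  have "card D + card X \<le> \<gamma>"
  proof -
    have "card D \<le> card Du + card Dq + card M"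
      unfolding D_def by (metis add_le_mono1 card_Un_le order_trans)
    moreover have "card X \<le> (if critical u then 1 else 0) + (if critical q then 1 else 0)"
      unfolding X_def by (intro order_trans[OF card_Un_le]) auto
    moreover have "card Du + (if critical u then 1 else 0) \<le> card (A \<inter> ?U)"
      "card Dq + (if critical q then 1 else 0) \<le> card (A \<inter> ?Q)"
      using D unfolding branch_set_def by (auto split: if_splits)
    moreover have "card A = card (A \<inter> ?U) + card (A \<inter> ?Q) + card M"
    proof -
      have "A = (A \<inter> ?U \<union> A \<inter> ?Q) \<union> M"
        by (auto simp: M_def)
      then have "card A = card (A \<inter> ?U \<union> A \<inter> ?Q) + card M"
        using finite_verts_subset[OF critical_subset] 
        by (subst card_Un_disjoint[symmetric]) (auto simp: M_def)
      also have "card (A \<inter> ?U \<union> A \<inter> ?Q) = card (A \<inter> ?U) + card (A \<inter> ?Q)"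
        using finite_verts_subset[OF critical_subset] disj by (intro card_Un_disjoint) auto
      finally show ?thesis .
    qed
    ultimately show ?thesis
      using domination_number_eq_card_critical[OF A] by linarith
  qed
  moreover have "x \<in> D \<or> (\<exists>w\<in>D. (x, w) \<in> E \<and> {x, w} \<notin> {{u, v}, {q, p}}) \<or> (\<exists>e\<in>X. x \<in> e)"
    if x: "x \<in> V" for x
  proof -
    consider "x \<in> ?U" | "x \<in> ?Q" | "x \<notin> ?U" "x \<notin> ?Q" by blast
    then show ?thesis
    proof cases
      case 1
      then have "{x, w} \<notin> {{u, v}, {q, p}}" if "w \<in> Du" for w
        using that sub UQ by (auto simp: doubleton_eq_iff)
      then show ?thesis
        using branch_set_covers[OF D(1) 1] by (auto simp: D_def X_def)
    next
      case 2
      then have "{x, w} \<notin> {{u, v}, {q, p}}" if "w \<in> Dq" for w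
        using that sub UQ by (auto simp: doubleton_eq_iff)
      then show ?thesis
        using branch_set_covers[OF D(2) 2] by (auto simp: D_def X_def)
    next
      case 3
      show ?thesis
      proof (cases "critical x")
        case True
        then show ?thesis using 3 by (simp add: D_def M_def)
      next
        case False
        then obtain c where c: "critical c" "(x, c) \<in> E"
          using A x unfolding covers_def by auto
        consider "c \<in> ?U" | "c \<in> ?Q" | "c \<in> M"
          using c by (auto simp: M_def)
        then show ?thesis
        proof cases
          case 1
          \<comment> \<open>The critical neighbour of \<open>x\<close> may have been replaced. Since
            \<open>x\<close> lies outside the side, \<open>xc\<close> is then the subdivided edge,
            and its new vertex dominates \<open>x\<close>.\<close>
          then have "c = u \<and> x = v"
            using side_step[OF uv 1 sym_E[OF c(2)]] 3 by blast
          then show ?thesis using c by (auto simp: X_def)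
        next
          case 2
          then have "c = q \<and> x = p"
            using side_step[OF qp 2 sym_E[OF c(2)]] 3 by blast
          then show ?thesis using c by (auto simp: X_def)
        next
          case M: 3
          then have "{x, c} \<notin> {{u, v}, {q, p}}"
            using 3 side_self[of u v] side_self[of q p] by (auto simp: M_def doubleton_eq_iff)
          then show ?thesis using M c by (auto simp: D_def)
        qed
      qed
    qed
  qed
  moreover have "e \<in> X \<or> e \<inter> D \<noteq> {}" if "e \<in> {{u, v}, {q, p}}" for e
  proof -
    \<comment> \<open>If neither \<open>u\<close> is critical nor \<open>u \<in> Du\<close>, then
      \<open>v\<close> is critical. It is kept in \<open>M\<close> unless it lies in the other side,
      and then the two edges coincide and \<open>q = v\<close> contributes the new vertex.\<close>
    have "{u, v} \<in> X \<or> {u, v} \<inter> D \<noteq> {}"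
    proof (cases "critical u \<or> u \<in> Du \<or> v \<notin> ?Q")
      case True
      then show ?thesis
        using D(1) UQ(5) unfolding branch_set_def by (auto simp: X_def D_def M_def split: if_splits)
    next
      case False
      then have "v = q \<and> u = p"
        using side_step[OF qp _ sym_E[OF uv]] UQ by blast
      then show ?thesis
        using D(1) False unfolding branch_set_def by (auto simp: X_def insert_commute split: if_splits)
    qed
    moreover have "{q, p} \<in> X \<or> {q, p} \<inter> D \<noteq> {}"
    proof (cases "critical q \<or> q \<in> Dq \<or> p \<notin> ?U")
      case True
      then show ?thesis
        using D(2) UQ(6) unfolding branch_set_def by (auto simp: X_def D_def M_def split: if_splits)
    next
      case False
      then have "p = u \<and> q = v"
        using side_step[OF uv _ sym_E[OF qp]] UQ by blast
      then show ?thesis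
        using D(2) False unfolding branch_set_def by (auto simp: X_def insert_commute split: if_splits)
    qed
    ultimately show ?thesis using that by blast
  qed
  moreover have "X \<subseteq> {{u, v}, {q, p}}"
    by (auto simp: X_def)
  ultimately show ?thesis
    unfolding domination_number_subdivide_edges_le_iff[OF pair_finite_verts finite.insertI[OF finite.insertI[OF finite.emptyI]] edges]
    using DV by (intro exI[of _ D] exI[of _ X] conjI ballI) blast+
qed

text \<open>The first side contains neither \<open>q\<close> nor \<open>p\<close>, so it never
  crosses the edge \<open>qp\<close> and stays in \<open>side p q\<close>.\<close>

lemma disjoint_sides:
  assumes "(u, v) \<in> E" "(q, p) \<in> E" "{u, v} \<noteq> {q, p}"
    and "q \<notin> side u v" "u \<notin> side q p"
  shows "side u v \<inter> side q p = {}"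
proof -
  have "p \<notin> side u v"
    using side_step[of u v p q] assms sym_E by (auto simp: doubleton_eq_iff)
  moreover have "u \<in> side p q"
    using side_iff[OF assms(2)] assms wellformed' by blast
  ultimately have "side u v \<subseteq> side p q"
    using side_step[OF sym_E[OF assms(2)]] by (intro side_subsetI) auto
  then show ?thesis
    using side_disjoint[OF assms(2)] by blast
qed

text \<open>Both edges can be oriented so that their sides are disjoint; for equal edges the two
  opposite sides serve.\<close>

lemma domination_number_subdivide_two_edges:
  assumes A: "covers A V" and e: "(u, v) \<in> E" and f: "(q, p) \<in> E"
  shows "domination_number (subdivide_edges T {{u, v}, {q, p}}) \<le> \<gamma>"
proof (cases "{u, v} = {q, p}")
  case True
  then have "domination_number (subdivide_edges T {{u, v}, {v, u}}) \<le> \<gamma>"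
    using domination_number_subdivide_disjoint_sides[OF A e sym_E[OF e]] side_disjoint[OF e] by blast
  then show ?thesis using True by (simp add: insert_commute)
next
  case False
  obtain u' v' where uv': "(u', v') \<in> E" "{u', v'} = {u, v}" "q \<notin> side u' v'"
  proof (cases "q \<in> side u v")
    case True
    then have "q \<notin> side v u" using side_disjoint[OF e] by blast
    then show ?thesis using that[of v u] sym_E[OF e] by (simp add: insert_commute)
  qed (use that e in blast)
  have p: "p \<notin> side u' v'"
    using side_step[OF uv'(1) _ sym_E[OF f]] uv' False by (auto simp: doubleton_eq_iff)
  obtain q' p' where qp': "(q', p') \<in> E" "{q', p'} = {q, p}" "u' \<notin> side q' p'"
  proof (cases "u' \<in> side q p")
    case True
    then have "u' \<notin> side p q" using side_disjoint[OF f] by blast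
    then show ?thesis using that[of p q] sym_E[OF f] by (simp add: insert_commute)
  qed (use that f in blast)
  have "q' \<notin> side u' v'"
    using p uv'(3) qp'(2) by (auto simp: doubleton_eq_iff)
  then have "side u' v' \<inter> side q' p' = {}"
    using disjoint_sides uv' qp' False by simp
  then show ?thesis
    using domination_number_subdivide_disjoint_sides[OF A uv'(1) qp'(1)] uv'(2) qp'(2) by simp
qed

lemma domination_number_subdivide_path_2:
  assumes A: "covers A V" and uv: "(u, v) \<in> E"
  shows "domination_number (subdivide_path T u v 2) \<le> \<gamma>"
proof -
  let ?U = "side u v" and ?W = "side v u"
  note vu = sym_E[OF uv]
  obtain Du Dv where D: "branch_set u v Du" "branch_set v u Dv"
    using ex_branch_set A uv vu by meson
  then have sub: "Du \<subseteq> ?U" "Dv \<subseteq> ?W"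
    by (auto simp: branch_set_def)
  have uV: "u \<in> V" "v \<in> V" using uv wellformed' by auto
  have UW: "?U \<subseteq> V" "?W \<subseteq> V" "u \<notin> ?W" "v \<notin> ?U" "?U \<inter> ?W = {}" "V = ?U \<union> ?W"
    using uV side_subset side_other uv vu side_disjoint side_compl[OF uv] by auto
  define X where "X = (if critical u then {1} else {}) \<union> (if critical v then {2::nat} else {})"
  have "card (Du \<union> Dv) + card X \<le> \<gamma>"
  proof -
    have "card (Du \<union> Dv) \<le> card Du + card Dv"
      by (rule card_Un_le)
    moreover have "card X \<le> (if critical u then 1 else 0) + (if critical v then 1 else 0)"
      unfolding X_def by (intro order_trans[OF card_Un_le]) auto
    moreover have "card Du + (if critical u then 1 else 0) \<le> card (A \<inter> ?U)"
      "card Dv + (if critical v then 1 else 0) \<le> card (A \<inter> ?W)"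
      using D unfolding branch_set_def by (auto split: if_splits)
    ultimately show ?thesis
      using domination_number_eq_card_critical[OF A] card_side[OF uv critical_subset] by linarith
  qed
  moreover have "a \<in> Du \<union> Dv \<or> (\<exists>b\<in>Du \<union> Dv. (a, b) \<in> E \<and> {a, b} \<noteq> {u, v}) \<or>
      a = u \<and> 1 \<in> X \<or> a = v \<and> 2 \<in> X" if "a \<in> V" for a
  proof (cases "a \<in> ?U")
    case True
    then have "{a, w} \<noteq> {u, v}" if "w \<in> Du" for w
      using that sub UW by (auto simp: doubleton_eq_iff)
    then show ?thesis
      using branch_set_covers[OF D(1) True] by (auto simp: X_def)
  next
    case False
    then have W: "a \<in> ?W" using that UW by blast
    then have "{a, w} \<noteq> {u, v}" if "w \<in> Dv" for w
      using that sub UW by (auto simp: doubleton_eq_iff)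
    then show ?thesis
      using branch_set_covers[OF D(2) W] by (auto simp: X_def)
  qed
  \<comment> \<open>A selected new vertex dominates both new vertices. If none is selected, neither
    end is critical and \<open>branch_set\<close> puts both ends into their sets.\<close>
  moreover have "1 \<in> X \<or> u \<in> Du \<union> Dv \<or> 2 \<in> X" "2 \<in> X \<or> v \<in> Du \<union> Dv \<or> 1 \<in> X"
    using D unfolding branch_set_def by (auto simp: X_def split: if_splits)
  then have "\<forall>i\<in>{1..2}. i \<in> X \<or> i = 1 \<and> u \<in> Du \<union> Dv \<or> i = 2 \<and> v \<in> Du \<union> Dv \<or>
      i < 2 \<and> Suc i \<in> X \<or> i > 1 \<and> i - 1 \<in> X"
    by (auto simp: le_Suc_eq numeral_2_eq_2)
  moreover have "X \<subseteq> {1..2}" "Du \<union> Dv \<subseteq> V"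
    using sub UW by (auto simp: X_def)
  ultimately show ?thesis
    unfolding domination_number_subdivide_path_le_iff[OF pair_finite_verts one_le_numeral]
    by (intro exI[of _ "Du \<union> Dv"] exI[of _ X] conjI ballI) blast+
qed

section \<open>Three subdivided edges that raise the domination number\<close>

lemma ex_neighbour:
  assumes "card V \<ge> 2" "u \<in> V"
  shows "\<exists>v. (u, v) \<in> E"
proof -
  have "V \<noteq> {u}" using assms(1) by auto
  then obtain x where "x \<in> V" "x \<noteq> u" using assms(2) by blast
  then show ?thesis
    using reachable_E[OF assms(2)] by (metis converse_rtranclE)
qed

lemma three_edges_subdivision:
  assumes A: "covers A V" and "card V \<ge> 2"
  shows "\<exists>F\<subseteq>edges T. card F = 3 \<and> domination_number (subdivide_edges T F) > \<gamma>"
proof -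
  have "V \<noteq> {}" using assms(2) by auto
  then obtain a where a: "critical a"
    using A unfolding covers_def by blast
  obtain P where P: "P \<subseteq> V" "covers P (V - {a})" "a \<notin> P" "\<And>y. (a, y) \<in> E \<Longrightarrow> y \<notin> P"
    using criticalE[OF a] by metis
  have aV: "a \<in> V" using a by (simp add: critical_def)
  obtain b where ab: "(a, b) \<in> E"
    using ex_neighbour[OF assms(2) aV] by blast
  then have b: "\<not> critical b" "b \<in> V" "b \<notin> P" "b \<noteq> a"
    using critical_not_adjacent a P(4) wellformed' no_loops' by blast+
  \<comment> \<open>Taking \<open>c\<close> from the witness for \<open>a\<close> ensures that it is
    neither \<open>a\<close> nor a neighbour of \<open>a\<close>; hence \<open>c\<close> is not
    critical, and its critical neighbour \<open>d\<close> differs from \<open>a\<close>.\<close>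
  then obtain c where c: "c \<in> P" "(b, c) \<in> E"
    using P(2) unfolding covers_def by blast
  then have c': "\<not> critical c" "c \<in> V" "c \<noteq> a" "c \<noteq> b" "(a, c) \<notin> E"
    using critical_no_common_neighbour[OF a _ ab, of c] P b(3) sym_E by blast+
  then obtain d where d: "critical d" "(c, d) \<in> E"
    using A unfolding covers_def by auto
  then have d': "d \<noteq> a" "d \<noteq> b" "d \<noteq> c"
    using c' b sym_E by blast+
  define F where "F = {{a, b}, {b, c}, {c, d}}"
  have F: "F \<subseteq> edges T"
    using ab c d by (auto simp: F_def edges_def)
  have "card F = 3"
    using b c' d' by (auto simp: F_def doubleton_eq_iff card_insert_if)
  have N: "(Inl x, Inl y) \<in> parcs (subdivide_edges T F) \<longleftrightarrow> (x, y) \<in> E \<and> {x, y} \<notin> F"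
    "(Inl x, Inr e) \<in> parcs (subdivide_edges T F) \<longleftrightarrow> e \<in> F \<and> x \<in> e"
    "(Inr e, Inl x) \<in> parcs (subdivide_edges T F) \<longleftrightarrow> e \<in> F \<and> x \<in> e"
    "(Inr e, Inr f) \<notin> parcs (subdivide_edges T F)" for x y e f
    by (auto simp: subdivide_edges_def)
  interpret H: pair_graph "subdivide_edges T F"
    using F by (intro pair_graph_subdivide_edges) unfold_locales
  let ?P = "insert (Inr {b, c}) (Inl ` A)"
  have bc: "{b, c} \<in> F" by (simp add: F_def)
  have uniq: "x = y" if "critical x" "critical y"
    "z = Inl x \<or> (Inl x, z) \<in> parcs (subdivide_edges T F)"
    "z = Inl y \<or> (Inl y, z) \<in> parcs (subdivide_edges T F)" for x y z
  proof (cases z)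
    case (Inl w)
    then show ?thesis
      using that critical_not_adjacent critical_no_common_neighbour by (auto simp: N)
  next
    case (Inr e)
    then have "e \<in> F" "x \<in> e" "y \<in> e"
      using that by (auto simp: N)
    then show ?thesis
      using that(1,2) b(1) c'(1) by (auto simp: F_def)
  qed
  \<comment> \<open>A common neighbour could only be \<open>b\<close> or \<open>c\<close>, whose
    unique critical neighbours are \<open>a\<close> and \<open>d\<close>; but the edges
    \<open>ab\<close> and \<open>cd\<close> are subdivided.\<close>
  have mid: False if x: "critical x"
    and z: "z = Inl x \<or> (Inl x, z) \<in> parcs (subdivide_edges T F)"
    "z = Inr {b, c} \<or> (Inr {b, c}, z) \<in> parcs (subdivide_edges T F)" for x z
  proof (cases z)
    case (Inl w)
    then have w: "w = b \<or> w = c" "w = x \<or> (x, w) \<in> E \<and> {x, w} \<notin> F"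
      using z by (auto simp: N)
    then have "(x, w) \<in> E" "{x, w} \<notin> F"
      using x b(1) c'(1) by auto
    moreover have "w = b \<Longrightarrow> (x, w) \<in> E \<Longrightarrow> x = a" "w = c \<Longrightarrow> (x, w) \<in> E \<Longrightarrow> x = d"
      using critical_no_common_neighbour x a ab d sym_E by blast+
    ultimately show ?thesis
      using w(1) by (auto simp: F_def insert_commute)
  next
    case (Inr e)
    then show ?thesis
      using z x b(1) c'(1) by (auto simp: N)
  qed
  have "card ?P \<le> domination_number (subdivide_edges T F)"
  proof (rule packing_le_domination_number)
    show "finite (pverts (subdivide_edges T F))"
      by (rule H.pair_finite_verts)
    show "?P \<subseteq> pverts (subdivide_edges T F)"
      using bc critical_subset by (auto simp: subdivide_edges_def)
    show "p = q" if "p \<in> ?P" "q \<in> ?P" "z = p \<or> (p, z) \<in> parcs (subdivide_edges T F)"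
      "z = q \<or> (q, z) \<in> parcs (subdivide_edges T F)" for p q z
      using that uniq[of _ _ z] mid[of _ z] by fastforce
  qed
  moreover have "card ?P = Suc \<gamma>"
    using domination_number_eq_card_critical[OF A] finite_verts_subset[OF critical_subset]
    by (subst card_insert_disjoint) (auto simp: card_image)
  ultimately show ?thesis
    using F \<open>card F = 3\<close> by (intro exI[of _ F]) auto
qed

section \<open>Trees not dominated by their critical vertices\<close>

text \<open>Each \<open>G c\<close> is a minimum cover containing \<open>w\<close> in which
  \<open>c\<close> does not rely on \<open>w\<close>. Replacing its branch at \<open>c\<close> by
  that of \<open>D0\<close> shows that this branch is no larger than in \<open>D0\<close>. The union
  of these branches does without \<open>w\<close>, which saves a vertex.\<close>

lemma merge_branches:
  assumes w: "w \<in> V" and C: "C \<subseteq> {c. (w, c) \<in> E}" and S: "S = insert w (\<Union>c\<in>C. side c w)"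
    and D0: "D0 \<subseteq> S" "w \<in> D0" "covers D0 S"
    and min: "\<And>D. D \<subseteq> S \<Longrightarrow> w \<in> D \<Longrightarrow> covers D S \<Longrightarrow> card D0 \<le> card D"
    and G: "\<And>c. c \<in> C \<Longrightarrow> G c \<subseteq> S \<and> w \<in> G c \<and> covers (G c) S \<and> card (G c) \<le> card D0"
    and G_covers: "\<And>c. c \<in> C \<Longrightarrow> c \<in> G c \<or> (\<exists>z\<in>G c. z \<noteq> w \<and> (c, z) \<in> E)"
  shows "covers (\<Union>c\<in>C. G c \<inter> side c w) (S - {w})"
    and "card (\<Union>c\<in>C. G c \<inter> side c w) < card D0"
proof -
  have cw: "(c, w) \<in> E" "c \<in> V" "w \<notin> side c w" if "c \<in> C" for c
    using that C sym_E side_other wellformed' by blast+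
  have "S \<subseteq> V"
    using S w cw(2) side_subset by blast
  then have fin: "finite D" if "D \<subseteq> S" for D
    using that finite_verts_subset by blast
  have "C \<subseteq> V" using cw by blast
  then have "finite C" by (rule finite_verts_subset)
  have disj: "side c w \<inter> side d w = {}" if "c \<in> C" "d \<in> C" "c \<noteq> d" for c d
    using side_branches_disjoint that C by blast
  show "covers (\<Union>c\<in>C. G c \<inter> side c w) (S - {w})"
    unfolding covers_def
  proof
    fix x assume "x \<in> S - {w}"
    then obtain c where c: "c \<in> C" "x \<in> side c w" and "x \<in> S"
      using S by blast
    \<comment> \<open>Within a branch only \<open>c\<close> is adjacent to \<open>w\<close>, and
      \<open>G_covers\<close> takes care of \<open>c\<close>.\<close>
    have "x \<in> G c \<or> (\<exists>z\<in>G c. z \<noteq> w \<and> (x, z) \<in> E)"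
    proof (cases "x = c")
      case False
      then have "(x, w) \<notin> E"
        using side_step[OF cw(1)[OF c(1)] c(2)] cw(3)[OF c(1)] by blast
      moreover have "x \<in> G c \<or> (\<exists>z\<in>G c. (x, z) \<in> E)"
        using G[OF c(1)] \<open>x \<in> S\<close> unfolding covers_def by blast
      ultimately show ?thesis by metis
    qed (use G_covers c in blast)
    then show "x \<in> (\<Union>c\<in>C. G c \<inter> side c w) \<or> (\<exists>y\<in>\<Union>c\<in>C. G c \<inter> side c w. (x, y) \<in> E)"
      using side_step[OF cw(1)[OF c(1)] c(2)] c by blast
  qed
  have le: "card (G c \<inter> side c w) \<le> card (D0 \<inter> side c w)" if c: "c \<in> C" for c
  proof -
    let ?B = "side c w"
    note Gc = G[OF c] and step = side_step[OF cw(1)[OF c]]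
    let ?D = "(G c - ?B) \<union> (D0 \<inter> ?B)"
    \<comment> \<open>Both sets contain \<open>w\<close>, so exchanging them across the edge
      \<open>cw\<close> leaves nothing undominated.\<close>
    have "covers ?D S"
      unfolding covers_def
    proof
      fix x assume "x \<in> S"
      show "x \<in> ?D \<or> (\<exists>y\<in>?D. (x, y) \<in> E)"
      proof (cases "x \<in> ?B")
        case True
        then show ?thesis
          using D0(3) \<open>x \<in> S\<close> step[OF True] Gc cw(3)[OF c] unfolding covers_def by blast
      next
        case False
        then show ?thesis
          using Gc \<open>x \<in> S\<close> step[of _ x] sym_E cw(3)[OF c] unfolding covers_def by blast
      qed
    qed
    then have "card D0 \<le> card ?D"
      using Gc D0 cw(3)[OF c] by (intro min) auto
    also have "\<dots> \<le> card (G c - ?B) + card (D0 \<inter> ?B)"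
      by (rule card_Un_le)
    finally show ?thesis
      using Gc card_Int_Diff[OF fin, of "G c" ?B] by linarith
  qed
  have "card (\<Union>c\<in>C. G c \<inter> side c w) \<le> (\<Sum>c\<in>C. card (G c \<inter> side c w))"
    using \<open>finite C\<close> by (rule card_UN_le)
  also have "\<dots> \<le> (\<Sum>c\<in>C. card (D0 \<inter> side c w))"
    using le by (rule sum_mono)
  also have "\<dots> = card (\<Union>c\<in>C. D0 \<inter> side c w)"
    using \<open>finite C\<close> fin[OF D0(1)] disj by (intro card_UN_disjoint[symmetric]) auto
  also have "\<dots> < card D0"
    using fin[OF D0(1)] D0(2) cw(3) by (intro psubset_card_mono) auto
  finally show "card (\<Union>c\<in>C. G c \<inter> side c w) < card D0" .
qed

definition minimum_with_both_ends :: "'a \<Rightarrow> 'a \<Rightarrow> bool" where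
  "minimum_with_both_ends u v \<longleftrightarrow> (\<exists>D\<subseteq>V. covers D V \<and> card D \<le> \<gamma> \<and> u \<in> D \<and> v \<in> D)"

lemma critical_covers:
  assumes "card V \<ge> 2"
    and both: "\<And>u v. (u, v) \<in> E \<Longrightarrow> critical u \<or> critical v \<or> minimum_with_both_ends u v"
  shows "covers A V"
proof (rule ccontr)
  assume "\<not> covers A V"
  then obtain w where w: "w \<in> V" "\<not> critical w" "\<And>c. (w, c) \<in> E \<Longrightarrow> \<not> critical c"
    unfolding covers_def by blast
  let ?C = "{c. (w, c) \<in> E}"
  have "\<forall>c\<in>?C. \<exists>D\<subseteq>V. covers D V \<and> card D \<le> \<gamma> \<and> w \<in> D \<and> c \<in> D"
    using both w unfolding minimum_with_both_ends_def by blast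
  then obtain G where G: "\<And>c. (w, c) \<in> E \<Longrightarrow> G c \<subseteq> V \<and> covers (G c) V \<and> card (G c) \<le> \<gamma> \<and> w \<in> G c \<and> c \<in> G c"
    by (metis mem_Collect_eq)
  obtain c where c: "(w, c) \<in> E"
    using ex_neighbour[OF assms(1) w(1)] by blast
  have card_c: "card (G c) = \<gamma>"
    using G[OF c] domination_number_le by (meson order.antisym)
  have V_eq: "V = insert w (\<Union>c\<in>?C. side c w)"
    using side_branches[OF w(1)] w(1) by blast
  let ?D = "\<Union>c\<in>?C. G c \<inter> side c w"
  have "covers ?D (V - {w})" "card ?D < card (G c)"
    using merge_branches[OF w(1) order.refl V_eq, of "G c" G] G c domination_number_le card_c by auto
  \<comment> \<open>Here every \<open>G c\<close> contains \<open>c\<close>, so the merged set still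
    dominates \<open>w\<close> although it omits it.\<close>
  moreover have "c \<in> ?D"
    using G c by auto
  ultimately have "covers ?D V"
    using c unfolding covers_def by blast
  moreover have "?D \<subseteq> V"
    using G by blast
  ultimately show False
    using domination_number_le \<open>card ?D < card (G c)\<close> card_c by (metis not_less)
qed

section \<open>Costs of dominating one side of an edge\<close>

definition min_cover :: "'a set \<Rightarrow> 'a set \<Rightarrow> 'a set \<Rightarrow> nat" where
  "min_cover R S X = (LEAST k. \<exists>D. R \<subseteq> D \<and> D \<subseteq> S \<and> covers D X \<and> card D = k)"

lemma min_cover_le: "R \<subseteq> D \<Longrightarrow> D \<subseteq> S \<Longrightarrow> covers D X \<Longrightarrow> min_cover R S X \<le> card D"
  unfolding min_cover_def by (intro Least_le) blast

lemma min_coverE: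
  assumes "R \<subseteq> S" "X \<subseteq> S"
  obtains D where "R \<subseteq> D" "D \<subseteq> S" "covers D X" "card D = min_cover R S X"
proof -
  let ?P = "\<lambda>k. \<exists>D. R \<subseteq> D \<and> D \<subseteq> S \<and> covers D X \<and> card D = k"
  have "covers S X"
    using assms(2) by (auto simp: covers_def)
  then have "?P (card S)"
    using assms(1) by blast
  then have "?P (min_cover R S X)"
    unfolding min_cover_def by (rule LeastI[of ?P])
  then show ?thesis using that by blast
qed

text \<open>The three costs stand for the three roles of \<open>u\<close>: left to the other side,
  dominated within its own side, or chosen.\<close>

definition free_cost :: "'a \<Rightarrow> 'a \<Rightarrow> nat" where
  "free_cost u v = min_cover {} (side u v) (side u v - {u})"

definition cover_cost :: "'a \<Rightarrow> 'a \<Rightarrow> nat" where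
  "cover_cost u v = min_cover {} (side u v) (side u v)"

definition root_cost :: "'a \<Rightarrow> 'a \<Rightarrow> nat" where
  "root_cost u v = min_cover {u} (side u v) (side u v)"

lemma free_cost_le: "D \<subseteq> side u v \<Longrightarrow> covers D (side u v - {u}) \<Longrightarrow> free_cost u v \<le> card D"
  unfolding free_cost_def by (intro min_cover_le) auto

lemma cover_cost_le: "D \<subseteq> side u v \<Longrightarrow> covers D (side u v) \<Longrightarrow> cover_cost u v \<le> card D"
  unfolding cover_cost_def by (intro min_cover_le) auto

lemma root_cost_le: "D \<subseteq> side u v \<Longrightarrow> covers D (side u v) \<Longrightarrow> u \<in> D \<Longrightarrow> root_cost u v \<le> card D"
  unfolding root_cost_def by (intro min_cover_le) auto

lemma free_costE:
  obtains D where "D \<subseteq> side u v" "covers D (side u v - {u})" "card D = free_cost u v"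
  by (rule min_coverE[of "{}" "side u v" "side u v - {u}"]) (use that in \<open>auto simp: free_cost_def\<close>)

lemma cover_costE:
  obtains D where "D \<subseteq> side u v" "covers D (side u v)" "card D = cover_cost u v"
  by (rule min_coverE[of "{}" "side u v" "side u v"]) (use that in \<open>auto simp: cover_cost_def\<close>)

lemma root_costE:
  obtains D where "D \<subseteq> side u v" "covers D (side u v)" "u \<in> D" "card D = root_cost u v"
  by (rule min_coverE[of "{u}" "side u v" "side u v"]) (use that in \<open>auto simp: root_cost_def\<close>)

lemma free_cost_le_cover_cost: "free_cost u v \<le> cover_cost u v"
  by (rule cover_costE[of u v]) (metis covers_mono free_cost_le Diff_subset order.refl)

lemma cover_cost_le_root_cost: "cover_cost u v \<le> root_cost u v"
  by (rule root_costE[of u v]) (metis cover_cost_le)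

lemma sides_eq:
  assumes "(u, v) \<in> E"
  shows "side u v \<union> side v u = V"
  using side_compl[OF assms] side_subset[of u v] assms wellformed' by blast

text \<open>The chosen \<open>u\<close> dominates \<open>v\<close>, the only vertex that the set on
  the other side may miss.\<close>

lemma domination_number_le_root_free:
  assumes uv: "(u, v) \<in> E"
  shows "\<gamma> \<le> root_cost u v + free_cost v u"
proof -
  obtain P where P: "P \<subseteq> side u v" "covers P (side u v)" "u \<in> P" "card P = root_cost u v"
    by (rule root_costE)
  obtain Q where Q: "Q \<subseteq> side v u" "covers Q (side v u - {v})" "card Q = free_cost v u"
    by (rule free_costE)
  have "covers (P \<union> Q) V"
    using covers_Un[OF P(2) Q(2)] P(3) sides_eq[OF uv] sym_E[OF uv] unfolding covers_def by blast
  then have "\<gamma> \<le> card (P \<union> Q)"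
    using P Q sides_eq[OF uv] by (intro domination_number_le) auto
  then show ?thesis
    using P Q card_Un_le[of P Q] by linarith
qed

text \<open>The two sets together miss at most \<open>u\<close>; with fewer than
  \<open>\<gamma>\<close> vertices they would make \<open>u\<close> critical.\<close>

lemma domination_number_le_free_cover:
  assumes uv: "(u, v) \<in> E" and "\<not> critical u"
  shows "\<gamma> \<le> free_cost u v + cover_cost v u"
proof -
  obtain P where P: "P \<subseteq> side u v" "covers P (side u v - {u})" "card P = free_cost u v"
    by (rule free_costE)
  obtain Q where Q: "Q \<subseteq> side v u" "covers Q (side v u)" "card Q = cover_cost v u"
    by (rule cover_costE)
  have "covers (P \<union> Q) (V - {u})"
    using covers_Un[OF P(2) Q(2)] sides_eq[OF uv] unfolding covers_def by blast
  moreover have "P \<union> Q \<subseteq> V" "u \<in> V"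
    using P Q sides_eq[OF uv] by auto
  ultimately have "\<gamma> \<le> card (P \<union> Q)"
    using assms(2) unfolding critical_def by (meson not_less)
  then show ?thesis
    using P Q card_Un_le[of P Q] by linarith
qed

lemma domination_number_less_root_root:
  assumes uv: "(u, v) \<in> E" and "\<not> minimum_with_both_ends u v"
  shows "\<gamma> < root_cost u v + root_cost v u"
proof -
  obtain P where P: "P \<subseteq> side u v" "covers P (side u v)" "u \<in> P" "card P = root_cost u v"
    by (rule root_costE)
  obtain Q where Q: "Q \<subseteq> side v u" "covers Q (side v u)" "v \<in> Q" "card Q = root_cost v u"
    by (rule root_costE)
  have "covers (P \<union> Q) V" "P \<union> Q \<subseteq> V"
    using covers_Un[OF P(2) Q(2)] P Q sides_eq[OF uv] by auto
  then have "\<gamma> < card (P \<union> Q)"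
    using P(3) Q(3) assms(2) unfolding minimum_with_both_ends_def by (meson UnCI not_less)
  then show ?thesis
    using P Q card_Un_le[of P Q] by linarith
qed

section \<open>Stable subdivisions in terms of costs\<close>

definition subdivision_stable :: "'a set set \<Rightarrow> bool" where
  "subdivision_stable F \<longleftrightarrow> domination_number (subdivide_edges T F) \<le> \<gamma>"

lemma finite_edges: "finite (edges T)"
proof -
  have "edges T \<subseteq> Pow V" 
    using wellformed' by (fastforce simp: edges_def)
  then show ?thesis
    using pair_finite_verts by (meson finite_Pow_iff finite_subset)
qed

lemma subdivision_stableE:
  assumes "F \<subseteq> edges T" "subdivision_stable F"
  obtains D X where "D \<subseteq> V" "X \<subseteq> F" "card D + card X \<le> \<gamma>"
    "\<And>x. x \<in> V \<Longrightarrow> x \<in> D \<or> (\<exists>w\<in>D. (x, w) \<in> E \<and> {x, w} \<notin> F) \<or> (\<exists>e\<in>X. x \<in> e)"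
    "\<And>e. e \<in> F \<Longrightarrow> e \<in> X \<or> e \<inter> D \<noteq> {}"
proof -
  have "finite F" using assms(1) finite_edges finite_subset by blast
  obtain D X where DX: "D \<subseteq> V" "X \<subseteq> F" "card D + card X \<le> \<gamma>"
    and dom: "\<forall>x\<in>V. x \<in> D \<or> (\<exists>w\<in>D. (x, w) \<in> E \<and> {x, w} \<notin> F) \<or> (\<exists>e\<in>X. x \<in> e)"
    and mid: "\<forall>e\<in>F. e \<in> X \<or> e \<inter> D \<noteq> {}"
    using assms(2)
    unfolding subdivision_stable_def domination_number_subdivide_edges_le_iff[OF pair_finite_verts \<open>finite F\<close> assms(1)]
    by (elim exE conjE)
  show ?thesis
    by (rule that[OF DX bspec[OF dom] bspec[OF mid]])
qed

text \<open>No old vertex dominates across the subdivided edge. Inside the side, \<open>K\<close>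
  stands in for the chosen new vertices.\<close>

lemma covers_side_subdivided:
  assumes "(u, v) \<in> E" "{u, v} \<in> F" "Y \<subseteq> side u v"
    and dom: "\<And>x. x \<in> V \<Longrightarrow> x \<in> D \<or> (\<exists>w\<in>D. (x, w) \<in> E \<and> {x, w} \<notin> F) \<or> (\<exists>e\<in>X. x \<in> e)"
    and X: "\<And>x e. x \<in> Y \<Longrightarrow> e \<in> X \<Longrightarrow> x \<in> e \<Longrightarrow> x \<in> K \<or> (\<exists>y\<in>K. (x, y) \<in> E)"
  shows "covers ((D \<inter> side u v) \<union> K) Y"
  unfolding covers_def
proof
  fix x assume x: "x \<in> Y"
  then have xU: "x \<in> side u v" "x \<in> V" 
    using assms(1,3) sides_eq[OF assms(1)] by auto
  consider "x \<in> D" | w where "w \<in> D" "(x, w) \<in> E" "{x, w} \<notin> F" | e where "e \<in> X" "x \<in> e"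
    using dom[OF xU(2)] by metis
  then show "x \<in> D \<inter> side u v \<union> K \<or> (\<exists>y\<in>D \<inter> side u v \<union> K. (x, y) \<in> E)"
  proof cases
    case 1
    then show ?thesis using xU by blast
  next
    case 2
    moreover from 2 have "w \<in> side u v"
      using side_step[OF assms(1) xU(1)] assms(2) by metis
    ultimately show ?thesis by blast
  next
    case 3
    then show ?thesis using X[OF x] by blast
  qed
qed

text \<open>A chosen new vertex relieves both ends. Without it, one end has to be chosen to dominate
  the new vertex, and each side dominates itself.\<close>

lemma stable_single_cases:
  assumes uv: "(u, v) \<in> E" and st: "subdivision_stable {{u, v}}"
  shows "free_cost u v + 1 + free_cost v u \<le> \<gamma> \<or> root_cost u v + cover_cost v u \<le> \<gamma> \<or>
    root_cost v u + cover_cost u v \<le> \<gamma>"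
proof -
  let ?U = "side u v" and ?W = "side v u"
  have "{{u, v}} \<subseteq> edges T" using uv by (auto simp: edges_def)
  then obtain D X where D: "D \<subseteq> V" "X \<subseteq> {{u, v}}" "card D + card X \<le> \<gamma>"
    and dom: "\<And>x. x \<in> V \<Longrightarrow> x \<in> D \<or> (\<exists>w\<in>D. (x, w) \<in> E \<and> {x, w} \<notin> {{u, v}}) \<or> (\<exists>e\<in>X. x \<in> e)"
    and mid: "\<And>e. e \<in> {{u, v}} \<Longrightarrow> e \<in> X \<or> e \<inter> D \<noteq> {}"
    by (rule subdivision_stableE[OF _ st]) blast
  note vu = sym_E[OF uv] and VUW = sides_eq[OF uv] and card_D = card_side[OF uv D(1)]
  have "covers (D \<inter> ?U \<union> {}) (?U - (if X = {} then {} else {u}))"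
    by (rule covers_side_subdivided[OF uv _ _ dom]) (use D(2) side_other[OF uv] in \<open>auto split: if_splits\<close>)
  moreover have "covers (D \<inter> ?W \<union> {}) (?W - (if X = {} then {} else {v}))"
    by (rule covers_side_subdivided[OF vu _ _ dom]) (use D(2) side_other[OF vu] in \<open>auto split: if_splits\<close>)
  ultimately have K: "covers (D \<inter> ?U) (?U - (if X = {} then {} else {u}))"
    "covers (D \<inter> ?W) (?W - (if X = {} then {} else {v}))"
    by simp_all
  show ?thesis
  proof (cases "X = {}")
    case True
    then have cov: "covers (D \<inter> ?U) ?U" "covers (D \<inter> ?W) ?W"
      using K by simp_all
    have "u \<in> D \<or> v \<in> D" 
      using mid True by blast
    then show ?thesis
    proof
      assume "u \<in> D"
      then have "root_cost u v \<le> card (D \<inter> ?U)" "cover_cost v u \<le> card (D \<inter> ?W)"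
        using cov by (auto intro!: root_cost_le cover_cost_le)
      then show ?thesis using card_D D(3) by linarith
    next
      assume "v \<in> D"
      then have "root_cost v u \<le> card (D \<inter> ?W)" "cover_cost u v \<le> card (D \<inter> ?U)"
        using cov by (auto intro!: root_cost_le cover_cost_le)
      then show ?thesis using card_D D(3) by linarith
    qed
  next
    case False
    then have X: "card X = 1" using D(2) by (metis card_1_singleton_iff One_nat_def subset_singletonD)
    have "free_cost u v \<le> card (D \<inter> ?U)" "free_cost v u \<le> card (D \<inter> ?W)"
      using K False by (auto intro!: free_cost_le)
    then show ?thesis using card_D D(3) X by linarith
  qed
qed

lemma card_subset_doubleton:
  assumes "X \<subseteq> {a, b}" "a \<noteq> b"
  shows "card X = (if a \<in> X then 1 else 0) + (if b \<in> X then 1 else 0)"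
proof -
  have "X = (if a \<in> X then {a} else {}) \<union> (if b \<in> X then {b} else {})"
    using assms(1) by auto
  moreover have "card ((if a \<in> X then {a} else {}) \<union> (if b \<in> X then {b} else {})) =
      (if a \<in> X then 1 else 0) + (if b \<in> X then 1 else 0)"
    using assms(2) by auto
  ultimately show ?thesis by simp
qed

text \<open>
  The subdivided pairs are \<open>uv\<close>, \<open>uc\<close> for the other neighbours \<open>c\<close> of \<open>u\<close>.  If none of them raised
  \<open>\<gamma>\<close>, the resulting minimum sets containing \<open>u\<close> would merge to one that dominates
  \<open>side u v - {u}\<close> too cheaply.
\<close>

lemma not_stable_if_root_cheap:
  assumes uv: "(u, v) \<in> E"
    and st: "\<forall>F\<subseteq>edges T. card F \<le> 2 \<longrightarrow> subdivision_stable F"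
    and costs: "\<gamma> \<le> root_cost u v + free_cost v u" "root_cost u v \<le> free_cost u v"
      "free_cost v u < root_cost v u"
  shows False
proof -
  let ?U = "side u v" and ?W = "side v u" and ?m = "root_cost u v"
  let ?C = "{c. (u, c) \<in> E} - {v}"
  have m_le: "?m \<le> cover_cost u v"
    using costs(2) free_cost_le_cover_cost le_trans by blast
  note vu = sym_E[OF uv] and VUW = sides_eq[OF uv]
  have uV: "u \<in> V" "v \<in> V" using uv wellformed' by auto
  have UW: "v \<notin> ?U" "u \<notin> ?W" "?U \<inter> ?W = {}"
    using side_other uv vu side_disjoint by auto
  have "\<exists>D. D \<subseteq> ?U \<and> u \<in> D \<and> covers D ?U \<and> card D \<le> ?m \<and> (c \<in> D \<or> (\<exists>z\<in>D. z \<noteq> u \<and> (c, z) \<in> E))"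
    if "c \<in> ?C" for c
  proof -
    have c: "(u, c) \<in> E" "c \<noteq> v" using that by auto
    have cU: "c \<in> ?U"
      using side_step[OF uv side_self c(1)] c(2) by blast
    have cu: "c \<noteq> u" using c(1) no_loops' by blast
    let ?F = "{{u, v}, {u, c}}"
    have F: "?F \<subseteq> edges T" using uv c by (auto simp: edges_def)
    have "subdivision_stable ?F" 
      using F by (intro st[rule_format]) (auto simp: card_insert_if)
    then obtain D X where D: "D \<subseteq> V" "X \<subseteq> ?F" "card D + card X \<le> \<gamma>"
      and dom: "\<And>x. x \<in> V \<Longrightarrow> x \<in> D \<or> (\<exists>w\<in>D. (x, w) \<in> E \<and> {x, w} \<notin> ?F) \<or> (\<exists>e\<in>X. x \<in> e)"
      and mid: "\<And>e. e \<in> ?F \<Longrightarrow> e \<in> X \<or> e \<inter> D \<noteq> {}"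
      by (rule subdivision_stableE[OF F]) blast
    have FV: "{u, v} \<noteq> {u, c}" using c(2) by (auto simp: doubleton_eq_iff)
    note card_D = card_side[OF uv D(1)] and cardX = card_subset_doubleton[OF D(2) FV]
    have coverU: "covers (D \<inter> ?U \<union> K) Y"
      if "Y \<subseteq> ?U" "\<And>x e. x \<in> Y \<Longrightarrow> e \<in> X \<Longrightarrow> x \<in> e \<Longrightarrow> x \<in> K \<or> (\<exists>y\<in>K. (x, y) \<in> E)" for K Y
      by (rule covers_side_subdivided[OF uv insertI1 that(1) dom that(2)])
    have coverW: "covers (D \<inter> ?W) Y"
      if "Y \<subseteq> ?W" "\<And>x e. x \<in> Y \<Longrightarrow> e \<in> X \<Longrightarrow> x \<notin> e" for Y
      using covers_side_subdivided[OF vu _ that(1) dom, where K = "{}"] that(2) by (auto simp: insert_commute)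
    have "covers (D \<inter> ?W) (?W - {v})"
      using D(2) UW cU by (intro coverW) auto
    then have k: "free_cost v u \<le> card (D \<inter> ?W)"
      by (intro free_cost_le) auto
    \<comment> \<open>With \<open>c\<close> in place of a chosen new vertex on \<open>uc\<close>,
      the new vertex on \<open>uv\<close> would come on top of both free costs, whose sum is already
      at least \<open>\<gamma>\<close>.\<close>
    have e: "{u, v} \<notin> X"
    proof
      assume e: "{u, v} \<in> X"
      let ?D = "(D \<inter> ?U) \<union> (if {u, c} \<in> X then {c} else {})"
      have "covers ?D (?U - {u})"
        using D(2) UW by (intro coverU) auto
      then have "free_cost u v \<le> card ?D"
        using cU by (intro free_cost_le) auto
      also have "\<dots> \<le> card (D \<inter> ?U) + (if {u, c} \<in> X then 1 else 0)"
        by (intro order_trans[OF card_Un_le]) auto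
      finally show False
        using costs k cardX e card_D D(3) by simp
    qed
    have covW: "covers (D \<inter> ?W) ?W"
      using D(2) UW cU e by (intro coverW) auto
    \<comment> \<open>If \<open>v\<close> were chosen, the sides would cost at least
      \<open>root_cost v u\<close> and \<open>cover_cost u v\<close>, again more than
      \<open>\<gamma>\<close> in total.\<close>
    have "v \<notin> D"
    proof
      assume "v \<in> D"
      then have "root_cost v u \<le> card (D \<inter> ?W)"
        using covW by (intro root_cost_le) auto
      let ?D = "(D \<inter> ?U) \<union> (if {u, c} \<in> X then {u} else {})"
      have "covers ?D ?U"
        using D(2) UW e sym_E[OF c(1)] by (intro coverU) auto
      then have "cover_cost u v \<le> card ?D"
        by (intro cover_cost_le) auto
      also have "\<dots> \<le> card (D \<inter> ?U) + (if {u, c} \<in> X then 1 else 0)"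
        by (intro order_trans[OF card_Un_le]) auto
      finally show False
        using costs m_le \<open>root_cost v u \<le> card (D \<inter> ?W)\<close> cardX e card_D D(3) by simp
    qed
    then have uD: "u \<in> D" using mid[of "{u, v}"] e by blast
    have "covers (D \<inter> ?U \<union> {u}) ?U"
      using D(2) UW e sym_E[OF c(1)] by (intro coverU) auto
    then have covU: "covers (D \<inter> ?U) ?U"
      using uD by (simp add: insert_absorb)
    have "{u, c} \<notin> X"
    proof
      assume "{u, c} \<in> X"
      then show False
        using cover_cost_le[OF _ covU] m_le costs k cardX card_D D(3) by simp
    qed
    then have "X = {}" using D(2) e by auto
    moreover have "{c, u} \<in> ?F" "c \<in> V"
      using cU VUW by (auto simp: insert_commute)
    \<comment> \<open>Since \<open>uc\<close> is subdivided and no new vertex is chosen,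
      \<open>c\<close> does not rely on \<open>u\<close>, as \<open>merge_branches\<close>
      requires.\<close>
    ultimately have "c \<in> D \<or> (\<exists>z\<in>D. z \<noteq> u \<and> (c, z) \<in> E \<and> {c, z} \<notin> ?F)"
      using dom[of c] by (metis empty_iff)
    then have "c \<in> D \<inter> ?U \<or> (\<exists>z\<in>D \<inter> ?U. z \<noteq> u \<and> (c, z) \<in> E)"
      using side_step[OF uv cU] cU by blast
    moreover have "card (D \<inter> ?U) \<le> ?m"
      using costs k card_D D(3) by linarith
    ultimately show ?thesis
      using covU uD by (intro exI[of _ "D \<inter> ?U"]) auto
  qed
  then obtain G where G: "\<And>c. c \<in> ?C \<Longrightarrow> G c \<subseteq> ?U \<and> u \<in> G c \<and> covers (G c) ?U \<and> card (G c) \<le> ?m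
      \<and> (c \<in> G c \<or> (\<exists>z\<in>G c. z \<noteq> u \<and> (c, z) \<in> E))"
    by metis
  obtain D0 where D0: "D0 \<subseteq> ?U" "covers D0 ?U" "u \<in> D0" "card D0 = ?m"
    by (rule root_costE)
  define B where "B = (\<Union>c\<in>?C. side c u)"
  have "{c. (u, c) \<in> E} = insert v ?C"
    using uv by blast
  then have "(\<Union>c\<in>{c. (u, c) \<in> E}. side c u) = (\<Union>c\<in>insert v ?C. side c u)"
    by (rule arg_cong)
  then have "V - {u} = B \<union> ?W"
    using side_branches[OF uV(1)] by (simp only: B_def UN_insert Un_commute)
  moreover have "B \<inter> ?W = {}"
    unfolding B_def using side_branches_disjoint[OF uv] by blast
  ultimately have "?U = insert u B"
    using VUW UW side_self[of u v] by blast
  then have U_eq: "?U = insert u (\<Union>c\<in>?C. side c u)"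
    by (simp only: B_def)
  let ?D = "\<Union>c\<in>?C. G c \<inter> side c u"
  have "covers ?D (?U - {u})"
    by (rule merge_branches(1)[OF uV(1) _ U_eq D0(1,3,2)]) (use G D0 root_cost_le in auto)
  then have "free_cost u v \<le> card ?D"
    using G by (intro free_cost_le) auto
  moreover have "card ?D < card D0"
    by (rule merge_branches(2)[OF uV(1) _ U_eq D0(1,3,2)]) (use G D0 root_cost_le in auto)
  ultimately show False
    using costs D0 by linarith
qed

text \<open>Subdividing \<open>vc\<close> as well forces \<open>v\<close> to be dominated at the
  expense of its own side. So either the new vertex on \<open>uv\<close> is paid for on top of
  \<open>free_cost u v\<close> and \<open>cover_cost v u\<close>, or both sides pay their cover
  cost. Either way the total is at least 2 above the sum of the free costs.\<close>

lemma not_stable_if_cover_expensive: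
  assumes uv: "(u, v) \<in> E" and c: "(v, c) \<in> E" "c \<noteq> u"
    and st: "\<forall>F\<subseteq>edges T. card F \<le> 2 \<longrightarrow> subdivision_stable F"
    and costs: "\<gamma> \<le> free_cost u v + free_cost v u + 1" "free_cost u v < cover_cost u v"
      "free_cost v u < cover_cost v u"
  shows False
proof -
  let ?U = "side u v" and ?W = "side v u" and ?F = "{{u, v}, {v, c}}"
  note vu = sym_E[OF uv] and VUW = sides_eq[OF uv]
  have UW: "v \<notin> ?U" "u \<notin> ?W" "?U \<inter> ?W = {}"
    using side_other uv vu side_disjoint by auto
  have cW: "c \<in> ?W" "c \<notin> ?U"
    using side_step[OF vu side_self c(1)] c(2) UW by auto
  have F: "?F \<subseteq> edges T" using uv c by (auto simp: edges_def)
  have "subdivision_stable ?F" 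
    using F by (intro st[rule_format]) (auto simp: card_insert_if)
  then obtain D X where D: "D \<subseteq> V" "X \<subseteq> ?F" "card D + card X \<le> \<gamma>"
    and dom: "\<And>x. x \<in> V \<Longrightarrow> x \<in> D \<or> (\<exists>w\<in>D. (x, w) \<in> E \<and> {x, w} \<notin> ?F) \<or> (\<exists>e\<in>X. x \<in> e)"
    and mid: "\<And>e. e \<in> ?F \<Longrightarrow> e \<in> X \<or> e \<inter> D \<noteq> {}"
    by (rule subdivision_stableE[OF F]) blast
  have FV: "{u, v} \<noteq> {v, c}" using c(2) by (auto simp: doubleton_eq_iff)
  note card_D = card_side[OF uv D(1)] and cardX = card_subset_doubleton[OF D(2) FV]
  have coverU: "covers (D \<inter> ?U) Y"
    if "Y \<subseteq> ?U" "\<And>x e. x \<in> Y \<Longrightarrow> e \<in> X \<Longrightarrow> x \<notin> e" for Y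
    using covers_side_subdivided[OF uv _ that(1) dom, where K = "{}"] that(2) by auto
  have coverW: "covers (D \<inter> ?W \<union> K) Y"
    if "Y \<subseteq> ?W" "\<And>x e. x \<in> Y \<Longrightarrow> e \<in> X \<Longrightarrow> x \<in> e \<Longrightarrow> x \<in> K \<or> (\<exists>y\<in>K. (x, y) \<in> E)" for K Y
    using covers_side_subdivided[OF vu _ that(1) dom that(2)] by (auto simp: insert_commute)
  \<comment> \<open>A chosen new vertex on \<open>vc\<close> is exchanged for
    \<open>v\<close>.\<close>
  let ?D = "(D \<inter> ?W) \<union> (if {v, c} \<in> X then {v} else {})"
  have card_le: "card ?D \<le> card (D \<inter> ?W) + (if {v, c} \<in> X then 1 else 0)"
    by (intro order_trans[OF card_Un_le]) auto
  show False
  proof (cases "{u, v} \<in> X")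
    case True
    have "covers (D \<inter> ?U) (?U - {u})"
      using D(2) UW cW by (intro coverU) auto
    then have "free_cost u v \<le> card (D \<inter> ?U)"
      by (intro free_cost_le) auto
    moreover have "covers ?D ?W"
    proof -
      have "covers ?D (?W - {v})"
        using D(2) UW sym_E[OF c(1)] by (intro coverW) auto
      moreover have "v \<in> ?D \<or> c \<in> ?D"
        using mid[of "{v, c}"] cW by auto
      ultimately show ?thesis
        using c(1) unfolding covers_def by blast
    qed
    then have "cover_cost v u \<le> card ?D"
      by (intro cover_cost_le) auto
    ultimately show ?thesis
      using card_le costs card_D D(3) cardX True by simp
  next
    case False
    have "covers (D \<inter> ?U) ?U"
      using D(2) UW cW False by (intro coverU) auto
    then have "cover_cost u v \<le> card (D \<inter> ?U)"
      by (intro cover_cost_le) auto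
    moreover have "covers ?D ?W"
      using D(2) UW False sym_E[OF c(1)] by (intro coverW) auto
    then have "cover_cost v u \<le> card ?D"
      by (intro cover_cost_le) auto
    ultimately show ?thesis
      using card_le costs card_D D(3) cardX by simp
  qed
qed

text \<open>Stability of \<open>uv\<close> alone leaves three cost patterns. If the conclusion
  failed, the bounds on \<open>\<gamma>\<close> would turn each pattern into the hypotheses of one
  of the two preceding lemmas.\<close>

lemma stable_edge:
  assumes uv: "(u, v) \<in> E" and "card V \<ge> 3"
    and st: "\<forall>F\<subseteq>edges T. card F \<le> 2 \<longrightarrow> subdivision_stable F"
  shows "critical u \<or> critical v \<or> minimum_with_both_ends u v"
proof (rule ccontr)
  assume neg: "\<not> ?thesis"
  note vu = sym_E[OF uv]
  have rr: "\<gamma> < root_cost u v + root_cost v u"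
    using domination_number_less_root_root[OF uv] neg by blast
  have fc: "\<gamma> \<le> free_cost u v + cover_cost v u" "\<gamma> \<le> free_cost v u + cover_cost u v"
    using domination_number_le_free_cover[OF uv] domination_number_le_free_cover[OF vu] neg by blast+
  note rf = domination_number_le_root_free[OF uv] domination_number_le_root_free[OF vu]
  note le = free_cost_le_cover_cost[of u v] free_cost_le_cover_cost[of v u]
    cover_cost_le_root_cost[of u v] cover_cost_le_root_cost[of v u]
  have "subdivision_stable {{u, v}}"
    using uv by (intro st[rule_format]) (auto simp: edges_def)
  then consider "free_cost u v + 1 + free_cost v u \<le> \<gamma>" | "root_cost u v + cover_cost v u \<le> \<gamma>"
    | "root_cost v u + cover_cost u v \<le> \<gamma>"
    using stable_single_cases[OF uv] by blast
  then show False
  proof cases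
    case 1
    have "V \<noteq> {u, v}"
      using assms(2) card_insert_le_m1[of 2 "{v}" u] by auto
    then obtain x where x: "x \<in> V" "x \<noteq> u" "x \<noteq> v"
      using uv wellformed' by blast
    \<comment> \<open>Here the third vertex matters: connectedness yields a further edge at
      \<open>u\<close> or \<open>v\<close> to subdivide.\<close>
    obtain y c where c: "y \<in> {u, v}" "(y, c) \<in> E" "c \<notin> {u, v}"
    proof -
      have "x \<in> {u, v} \<or> (\<exists>y\<in>{u, v}. \<exists>c. (y, c) \<in> E \<and> c \<notin> {u, v})"
        if "(u, x) \<in> E\<^sup>*" for x
        using that by (induction rule: rtrancl_induct) auto
      then show ?thesis
        using that x reachable_E uv wellformed' by blast
    qed
    have less: "free_cost u v < cover_cost u v" "free_cost v u < cover_cost v u"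
      "\<gamma> \<le> free_cost u v + free_cost v u + 1" "\<gamma> \<le> free_cost v u + free_cost u v + 1"
    proof -
      obtain D where "D \<subseteq> side u v" "covers D (side u v - {u})" "card D = free_cost u v"
        by (rule free_costE)
      moreover from this have "cover_cost u v \<le> card (insert u D)"
        by (intro cover_cost_le) (auto simp: covers_def)
      ultimately have "cover_cost u v \<le> free_cost u v + 1"
        using card_insert_le_m1[of "Suc (card D)" D u] by simp
      then show "free_cost u v < cover_cost u v" "free_cost v u < cover_cost v u"
        "\<gamma> \<le> free_cost u v + free_cost v u + 1" "\<gamma> \<le> free_cost v u + free_cost u v + 1"
        using fc 1 by linarith+
    qed
    from c(1) consider "y = u" | "y = v" by blast
    then show False
    proof cases
      case 1
      then have "(u, c) \<in> E" "c \<noteq> v" using c by auto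
      then show False
        by (rule not_stable_if_cover_expensive[OF vu _ _ st less(4,2,1)])
    next
      case 2
      then have "(v, c) \<in> E" "c \<noteq> u" using c by auto
      then show False
        by (rule not_stable_if_cover_expensive[OF uv _ _ st less(3,1,2)])
    qed
  next
    case 2
    then show False
      by (intro not_stable_if_root_cheap[OF uv st]) (use fc rf le rr in linarith)+
  next
    case 3
    then show False
      by (intro not_stable_if_root_cheap[OF vu st]) (use fc rf le rr in linarith)+
  qed
qed

lemma ex_stable_fails:
  assumes "card V \<ge> 3" "\<not> covers A V"
  shows "\<exists>F\<subseteq>edges T. card F \<le> 2 \<and> \<not> subdivision_stable F"
  using stable_edge critical_covers assms by (metis Suc_leD eval_nat_numeral(2,3) One_nat_def)

section \<open>Both subdivision numbers\<close>

text \<open>The middle new vertex forces one into \<open>X\<close>. If \<open>X\<close> has one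
  element, \<open>D\<close> alone dominates the tree: a chosen end vertex of the new path leaves the
  opposite new vertex to \<open>v\<close> or \<open>u\<close>, which restores the edge. If
  \<open>X\<close> is larger, adding \<open>u\<close> to \<open>D\<close> suffices. Both sets are
  too small.\<close>

lemma subdivide_path_3:
  assumes uv: "(u, v) \<in> E"
  shows "\<gamma> < domination_number (subdivide_path T u v 3)"
proof (rule ccontr)
  assume "\<not> ?thesis"
  then have "domination_number (subdivide_path T u v 3) \<le> \<gamma>" by simp
  then obtain D X where D: "D \<subseteq> V" "X \<subseteq> {1..3}" "card D + card X \<le> \<gamma>"
    and dom: "\<forall>a\<in>V. a \<in> D \<or> (\<exists>b\<in>D. (a, b) \<in> E \<and> {a, b} \<noteq> {u, v}) \<or>
      a = u \<and> 1 \<in> X \<or> a = v \<and> 3 \<in> X"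
    and mid: "\<forall>i\<in>{1..3}. i \<in> X \<or> i = 1 \<and> u \<in> D \<or> i = 3 \<and> v \<in> D \<or> i < 3 \<and> Suc i \<in> X \<or> i > 1 \<and> i - 1 \<in> X"
    unfolding domination_number_subdivide_path_le_iff[OF pair_finite_verts one_le_numeral]
    by (elim exE conjE)
  have m: "1 \<in> X \<or> u \<in> D \<or> 2 \<in> X" "2 \<in> X \<or> 3 \<in> X \<or> 1 \<in> X" "3 \<in> X \<or> v \<in> D \<or> 2 \<in> X"
    using bspec[OF mid, of 1] bspec[OF mid, of 2] bspec[OF mid, of 3] by (auto simp: numeral_eq_Suc)
  have uV: "u \<in> V" using uv wellformed' by blast
  have fin: "finite X" using D(2) finite_subset by blast
  show False
  proof (cases "card X \<ge> 2")
    case True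
    have "covers (insert u D) V"
      unfolding covers_def using dom sym_E[OF uv] by blast
    then have "\<gamma> \<le> card (insert u D)"
      using D(1) uV by (intro domination_number_le) auto
    also have "\<dots> \<le> Suc (card D)"
      by (rule card_insert_le_m1) auto
    finally show ?thesis
      using True D(3) by linarith
  next
    case False
    moreover have "X \<noteq> {}" using m(2) by blast
    ultimately have "card X = 1"
      using fin by (metis One_nat_def Suc_1 card_0_eq le_less_Suc_eq not_less_eq_eq not_less0 leI less_one)
    then obtain i where i: "X = {i}" by (rule card_1_singletonE)
    then have "1 \<in> X \<Longrightarrow> v \<in> D" "3 \<in> X \<Longrightarrow> u \<in> D"
      using m by auto
    then have "covers D V"
      unfolding covers_def using dom uv sym_E[OF uv] by blast
    then have "\<gamma> \<le> card D"
      using D(1) by (intro domination_number_le)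
    then show ?thesis
      using D(3) \<open>card X = 1\<close> by linarith
  qed
qed

text \<open>If exactly one new vertex is chosen, its old neighbour is critical; if none, both ends
  are chosen. Choosing both is too expensive, since \<open>u\<close> could replace them.\<close>

lemma subdivide_path_2_stable:
  assumes uv: "(u, v) \<in> E" and "domination_number (subdivide_path T u v 2) \<le> \<gamma>"
  shows "critical u \<or> critical v \<or> minimum_with_both_ends u v"
proof -
  obtain D X where D: "D \<subseteq> V" "X \<subseteq> {1..2}" "card D + card X \<le> \<gamma>"
    and dom: "\<forall>a\<in>V. a \<in> D \<or> (\<exists>b\<in>D. (a, b) \<in> E \<and> {a, b} \<noteq> {u, v}) \<or>
      a = u \<and> 1 \<in> X \<or> a = v \<and> 2 \<in> X"
    and mid: "\<forall>i\<in>{1..2}. i \<in> X \<or> i = 1 \<and> u \<in> D \<or> i = 2 \<and> v \<in> D \<or> i < 2 \<and> Suc i \<in> X \<or> i > 1 \<and> i - 1 \<in> X"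
    using assms(2) 
    unfolding domination_number_subdivide_path_le_iff[OF pair_finite_verts one_le_numeral]
    by (elim exE conjE)
  have m: "1 \<in> X \<or> u \<in> D \<or> 2 \<in> X" "2 \<in> X \<or> v \<in> D \<or> 1 \<in> X"
    using bspec[OF mid, of 1] bspec[OF mid, of 2] by (auto simp: numeral_eq_Suc)
  have uV: "u \<in> V" "v \<in> V" using uv wellformed' by auto
  have fin: "finite X" using D(2) finite_subset by blast
  consider "1 \<in> X" "2 \<in> X" | "1 \<in> X" "2 \<notin> X" | "1 \<notin> X" "2 \<in> X" | "1 \<notin> X" "2 \<notin> X"
    by blast
  then show ?thesis
  proof cases
    case 1
    then have "card {1::nat, 2} \<le> card X"
      using fin by (intro card_mono) auto
    then have "2 \<le> card X" by simp
    have "covers (insert u D) V"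
      unfolding covers_def using dom sym_E[OF uv] by blast
    then have "\<gamma> \<le> card (insert u D)"
      using D(1) uV by (intro domination_number_le) auto
    also have "\<dots> \<le> Suc (card D)"
      by (rule card_insert_le_m1) auto
    finally show ?thesis
      using \<open>2 \<le> card X\<close> D(3) by linarith
  next
    case 2
    then have "card X > 0" using fin by (auto simp: card_gt_0_iff)
    moreover have "covers D (V - {u})"
      unfolding covers_def using dom 2 by blast
    ultimately have "critical u"
      using D uV unfolding critical_def by (intro conjI exI[of _ D]) auto
    then show ?thesis by simp
  next
    case 3
    then have "card X > 0" using fin by (auto simp: card_gt_0_iff)
    moreover have "covers D (V - {v})"
      unfolding covers_def using dom 3 by blast
    ultimately have "critical v"
      using D uV unfolding critical_def by (intro conjI exI[of _ D]) auto
    then show ?thesis by simp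
  next
    case 4
    then have "u \<in> D" "v \<in> D" using m by auto
    moreover have "covers D V"
      unfolding covers_def using dom 4 by blast
    ultimately have "minimum_with_both_ends u v"
      using D unfolding minimum_with_both_ends_def by (intro exI[of _ D]) auto
    then show ?thesis by simp
  qed
qed

lemma stable_empty: "subdivision_stable {}"
proof -
  obtain D where D: "D \<subseteq> V" "covers D V" "card D \<le> \<gamma>"
    by (rule minimum_dominating_set)
  then show ?thesis
    unfolding subdivision_stable_def domination_number_subdivide_edges_le_iff[OF pair_finite_verts finite.emptyI empty_subsetI]
    by (intro exI[of _ D] exI[of _ "{}"]) (auto simp: covers_def)
qed

lemma stable_path_1: 
  assumes "(u, v) \<in> E"
  shows "subdivision_stable {{u, v}} \<longleftrightarrow> domination_number (subdivide_path T u v 1) \<le> \<gamma>"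
  using domination_number_subdivide_path_1[OF pair_finite_verts assms] by (simp add: subdivision_stable_def)

lemma edgesE:
  assumes "e \<in> edges T"
  obtains u v where "e = {u, v}" "(u, v) \<in> E"
  using assms by (auto simp: edges_def)

section \<open>Evaluating the minima\<close>

lemma sd_eqI:
  assumes "F \<subseteq> edges T" "\<not> subdivision_stable F"
    and "\<And>F'. F' \<subseteq> edges T \<Longrightarrow> card F' < card F \<Longrightarrow> subdivision_stable F'"
  shows "sd T = card F"
  unfolding sd_def
proof (rule Least_equality)
  show "\<exists>F'\<subseteq>edges T. card F' = card F \<and> \<gamma> < domination_number (subdivide_edges T F')"
    using assms(1,2) by (auto simp: subdivision_stable_def)
  show "card F \<le> k" if "\<exists>F'\<subseteq>edges T. card F' = k \<and> \<gamma> < domination_number (subdivide_edges T F')" for k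
    using that assms(3) by (auto simp: subdivision_stable_def not_less[symmetric])
qed

lemma msd_edge_le: "t \<ge> 1 \<Longrightarrow> \<gamma> < domination_number (subdivide_path T u v t) \<Longrightarrow> msd_edge T u v \<le> t"
  unfolding msd_edge_def by (rule Least_le) simp

lemma msd_edge_works:
  assumes "(u, v) \<in> E"
  shows "msd_edge T u v \<ge> 1 \<and> \<gamma> < domination_number (subdivide_path T u v (msd_edge T u v))"
proof -
  let ?P = "\<lambda>t. t \<ge> 1 \<and> \<gamma> < domination_number (subdivide_path T u v t)"
  have "?P 3" using subdivide_path_3[OF assms] by simp
  then show ?thesis
    unfolding msd_edge_def by (rule LeastI[of ?P])
qed

lemma msd_eqI:
  assumes "(u, v) \<in> E" "msd_edge T u v \<le> k" "\<And>u v. (u, v) \<in> E \<Longrightarrow> k \<le> msd_edge T u v"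
  shows "msd T = k"
  unfolding msd_def
proof (rule Min_eqI)
  show "finite ((\<lambda>(u, v). msd_edge T u v) ` E)"
    using pair_finite_arcs by simp
  show "k \<le> y" if "y \<in> (\<lambda>(u, v). msd_edge T u v) ` E" for y
    using that assms(3) by auto
  have "msd_edge T u v = k"
    using assms by (simp add: order.antisym)
  then show "k \<in> (\<lambda>(u, v). msd_edge T u v) ` E"
    using assms(1) by force
qed

lemma card_le_1_stable:
  assumes "\<And>u v. (u, v) \<in> E \<Longrightarrow> subdivision_stable {{u, v}}" "F \<subseteq> edges T" "card F \<le> 1"
  shows "subdivision_stable F"
proof -
  have "finite F"
    using assms(2) finite_edges finite_subset by blast
  then consider "F = {}" | e where "F = {e}"
    using assms(3) by (metis card_1_singletonE card_0_eq le_antisym less_one not_less)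
  then show ?thesis
  proof cases
    case 2
    then show ?thesis using assms(1,2) edgesE by (metis insert_subset)
  qed (simp add: stable_empty)
qed

lemma sd_eq_msd:
  assumes n: "card V \<ge> 3"
  shows "sd T = msd T"
proof -
  have two: "card V \<ge> 2" using n by simp
  then have "V \<noteq> {}" by auto
  then obtain u0 v0 where uv0: "(u0, v0) \<in> E"
    using ex_neighbour[OF two] by blast
  show ?thesis
  proof (cases "\<exists>u v. (u, v) \<in> E \<and> \<not> subdivision_stable {{u, v}}")
    case True
    then obtain u v where uv: "(u, v) \<in> E" "\<not> subdivision_stable {{u, v}}" by blast
    have "sd T = card {{u, v}}"
    proof (rule sd_eqI)
      show "{{u, v}} \<subseteq> edges T" using uv(1) by (auto simp: edges_def)
      show "subdivision_stable F" if "F \<subseteq> edges T" "card F < card {{u, v}}" for F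
      proof -
        have "finite F" using that(1) finite_edges finite_subset by blast
        then show ?thesis using that(2) stable_empty by simp
      qed
    qed (use uv in simp)
    moreover have "msd T = 1"
    proof (rule msd_eqI[OF uv(1)])
      show "msd_edge T u v \<le> 1"
        using uv stable_path_1 by (intro msd_edge_le) auto
    qed (use msd_edge_works in blast)
    ultimately show ?thesis by simp
  next
    case False
    then have one: "\<And>u v. (u, v) \<in> E \<Longrightarrow> subdivision_stable {{u, v}}" by blast
    have ge_2: "msd_edge T u v \<ge> 2" if "(u, v) \<in> E" for u v
    proof -
      have "msd_edge T u v \<noteq> 1"
        using msd_edge_works[OF that] one[OF that] stable_path_1[OF that] by auto
      then show ?thesis using msd_edge_works[OF that] by linarith
    qed
    show ?thesis
    proof (cases "covers A V")
      case A: True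
      obtain F where F: "F \<subseteq> edges T" "card F = 3" "\<not> subdivision_stable F"
        using three_edges_subdivision[OF A two] unfolding subdivision_stable_def by (metis not_less)
      have "sd T = card F"
      proof (rule sd_eqI[OF F(1,3)])
        fix F' assume F': "F' \<subseteq> edges T" "card F' < card F"
        show "subdivision_stable F'"
        proof (cases "card F' \<le> 1")
          case True
          then show ?thesis using one F'(1) card_le_1_stable by blast
        next
          case False
          then have "card F' = 2" using F' F(2) by linarith
          then obtain e f where ef: "F' = {e, f}" by (meson card_2_iff)
          then have "e \<in> edges T" "f \<in> edges T" using F'(1) by auto
          then obtain u v q p where "e = {u, v}" "(u, v) \<in> E" "f = {q, p}" "(q, p) \<in> E"
            by (metis edgesE)
          then show ?thesis
            using domination_number_subdivide_two_edges[OF A] ef unfolding subdivision_stable_def by simp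
        qed
      qed
      moreover have "msd T = 3"
      proof (rule msd_eqI[OF uv0])
        show "msd_edge T u0 v0 \<le> 3"
          using subdivide_path_3[OF uv0] by (intro msd_edge_le) auto
        show "3 \<le> msd_edge T u v" if "(u, v) \<in> E" for u v
        proof -
          have "msd_edge T u v \<noteq> 2"
            using msd_edge_works[OF that] domination_number_subdivide_path_2[OF A that] by auto
          then show ?thesis using ge_2[OF that] by linarith
        qed
      qed
      ultimately show ?thesis using F(2) by simp
    next
      case A: False
      obtain F where F: "F \<subseteq> edges T" "card F \<le> 2" "\<not> subdivision_stable F"
        using ex_stable_fails[OF n A] by blast
      then have "card F = 2"
        using card_le_1_stable[OF one F(1)] by fastforce
      then have "sd T = 2"
        using sd_eqI[OF F(1,3)] card_le_1_stable[OF one] by simp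
      \<comment> \<open>By contraposition: if two new vertices never raised \<open>\<gamma>\<close>,
        then \<open>subdivide_path_2_stable\<close> and \<open>critical_covers\<close> would make
        \<open>A\<close> dominating.\<close>
      moreover obtain u v where uv: "(u, v) \<in> E" "\<not> domination_number (subdivide_path T u v 2) \<le> \<gamma>"
        using critical_covers[OF two] A subdivide_path_2_stable by blast
      then have "msd T = 2"
        using ge_2 by (intro msd_eqI[OF uv(1)] msd_edge_le) auto
      ultimately show ?thesis by simp
    qed
  qed
qed

end

theorem theorem4:
  fixes T :: "'a pair_pre_digraph"
  assumes "undirected_tree T"
    and "card (pverts T) \<ge> 3"
  shows "sd T = msd T"
proof -
  interpret undirected_tree_graph T
    using assms(1) by unfold_locales
  show ?thesis
    using assms(2) by (rule sd_eq_msd)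
qed

end
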